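(* Let $X$ be a closed connected manifold and let $X'\to X$ be a finite covering. Then $\operatorname{disc-sym}(X')\geq\operatorname{disc-sym}(X)$.
   Context: All group actions on manifolds are continuous. Manifolds are topological manifolds, and closed means compact without boundary. For a closed topological manifold $X$, let $\mu(X)$ be the set of natural numbers $m$ for which there is a sequence of integers $r_i\to\infty$ and, for each $i$, an effective action of $(\mathbb{Z}/r_i)^m$ on $X$. The set $\mu(X)$ is finite, and $\operatorname{disc-sym}(X):=\max(\{0\}\cup\mu(X))$. *)

theory Defs
  imports
    "HOL-Analysis.Analysis"
    "HOL-Algebra.Group_Action"
    "HOL-Algebra.Elementary_Groups"
    "HOL-Algebra.Product_Groups"
    "HOL-Library.Extended_Nat"
begin

definition topological_manifold :: "nat \<Rightarrow> 'a topology \<Rightarrow> bool" where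
  "topological_manifold n X \<longleftrightarrow>
     Hausdorff_space X \<and> second_countable X \<and>
     (\<forall>x \<in> topspace X. \<exists>U V. openin X U \<and> x \<in> U \<and> openin (Euclidean_space n) V \<and>
        subtopology X U homeomorphic_space subtopology (Euclidean_space n) V)"

definition closed_manifold :: "'a topology \<Rightarrow> bool" where
  "closed_manifold X \<longleftrightarrow> (\<exists>n. topological_manifold n X) \<and> compact_space X"

text \<open>The version of \<^const>\<open>covering_space\<close> for abstract topologies; the two agree
  on subspaces of a type-class topological space by \<open>covering_map_top_of_set\<close> below.\<close>

definition covering_map :: "'a topology \<Rightarrow> 'b topology \<Rightarrow> ('a \<Rightarrow> 'b) \<Rightarrow> bool" where
  "covering_map C X p \<longleftrightarrow>
     continuous_map C X p \<and> p ` topspace C = topspace X \<and>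
     (\<forall>x \<in> topspace X. \<exists>T. x \<in> T \<and> openin X T \<and>
        (\<exists>\<V>. \<Union>\<V> = {c \<in> topspace C. p c \<in> T} \<and>
             (\<forall>U \<in> \<V>. openin C U) \<and>
             pairwise disjnt \<V> \<and>
             (\<forall>U \<in> \<V>. homeomorphic_map (subtopology C U) (subtopology X T) p)))"

lemma covering_map_top_of_set:
  "covering_map (top_of_set C) (top_of_set S) p \<longleftrightarrow> covering_space C p S"
proof -
  have maps: "homeomorphic_maps (top_of_set U) (top_of_set T) p q \<longleftrightarrow> homeomorphism U T p q" for U T q
  proof
    assume "homeomorphic_maps (top_of_set U) (top_of_set T) p q"
    then have "continuous_on U p" "p \<in> U \<rightarrow> T" "continuous_on T q" "q \<in> T \<rightarrow> U"
      "\<forall>x\<in>U. q (p x) = x" "\<forall>y\<in>T. p (q y) = y"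
      by (auto simp: homeomorphic_maps_def continuous_map_in_subtopology)
    then show "homeomorphism U T p q"
      by (intro homeomorphismI) auto
  next
    assume "homeomorphism U T p q"
    then show "homeomorphic_maps (top_of_set U) (top_of_set T) p q"
      by (auto simp: homeomorphism_def homeomorphic_maps_def continuous_map_in_subtopology)
  qed
  have hom: "homeomorphic_map (subtopology (top_of_set C) U) (subtopology (top_of_set S) T) p
      \<longleftrightarrow> (\<exists>q. homeomorphism U T p q)"
    if "U \<subseteq> C" "T \<subseteq> S" for U T
    using that by (simp add: subtopology_subtopology inf.absorb2 homeomorphic_map_maps maps)
  have pre: "{c \<in> topspace (top_of_set C). p c \<in> T} = C \<inter> p -` T" for T
    by auto
  have sheets: "(\<forall>U \<in> \<V>. homeomorphic_map (subtopology (top_of_set C) U) (subtopology (top_of_set S) T) p)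
      \<longleftrightarrow> (\<forall>U \<in> \<V>. \<exists>q. homeomorphism U T p q)"
    if "\<forall>U \<in> \<V>. openin (top_of_set C) U" "openin (top_of_set S) T" for \<V> T
    using that by (meson hom openin_imp_subset)
  have cont: "continuous_map (top_of_set C) (top_of_set S) p \<and> p ` C = S
      \<longleftrightarrow> continuous_on C p \<and> p ` C = S"
    by (auto simp: continuous_map_in_subtopology)
  have sheeted: "(x \<in> T \<and> openin (top_of_set S) T \<and>
        (\<exists>\<V>. \<Union>\<V> = C \<inter> p -` T \<and> (\<forall>U \<in> \<V>. openin (top_of_set C) U) \<and> pairwise disjnt \<V> \<and>
          (\<forall>U \<in> \<V>. homeomorphic_map (subtopology (top_of_set C) U) (subtopology (top_of_set S) T) p)))
      \<longleftrightarrow> (x \<in> T \<and> openin (top_of_set S) T \<and>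
        (\<exists>\<V>. \<Union>\<V> = C \<inter> p -` T \<and> (\<forall>U \<in> \<V>. openin (top_of_set C) U) \<and> pairwise disjnt \<V> \<and>
          (\<forall>U \<in> \<V>. \<exists>q. homeomorphism U T p q)))" for x T
    by (intro conj_cong refl ex_cong1) (rule sheets)
  show ?thesis
    unfolding covering_map_def covering_space_def pre sheeted
    using cont by (auto simp: continuous_map_in_subtopology)
qed

definition finite_covering_map :: "'a topology \<Rightarrow> 'b topology \<Rightarrow> ('a \<Rightarrow> 'b) \<Rightarrow> bool" where
  "finite_covering_map C X p \<longleftrightarrow>
     covering_map C X p \<and> (\<forall>x \<in> topspace X. finite {c \<in> topspace C. p c = x})"

definition effective_continuous_action ::
    "('g, 'm) monoid_scheme \<Rightarrow> 'a topology \<Rightarrow> ('g \<Rightarrow> 'a \<Rightarrow> 'a) \<Rightarrow> bool" where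
  "effective_continuous_action G X \<phi> \<longleftrightarrow>
     faithful_action G (topspace X) \<phi> \<and> (\<forall>g \<in> carrier G. continuous_map X X (\<phi> g))"

text \<open>The group \<open>(\<int>/r)\<^sup>m\<close>. The absolute value makes \<open>\<int>/r\<close> correct for every integer \<open>r\<close>,
  although a sequence tending to infinity has only finitely many nonpositive terms.\<close>

definition Zmod_power :: "int \<Rightarrow> nat \<Rightarrow> (nat \<Rightarrow> int) monoid" where
  "Zmod_power r m = product_group {..<m} (\<lambda>_. integer_mod_group (nat \<bar>r\<bar>))"

definition mu :: "'a topology \<Rightarrow> nat set" where
  "mu X = {m. \<exists>r :: nat \<Rightarrow> int. filterlim r at_top sequentially \<and>
                (\<forall>i. \<exists>\<phi>. effective_continuous_action (Zmod_power (r i) m) X \<phi>)}"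

text \<open>For a closed manifold \<open>mu X\<close> is finite (a theorem of Mann and Su), so the value is always
  the maximum. That theorem is not available here, and \<^const>\<open>Max\<close> is unspecified on infinite
  sets; the codomain \<^typ>\<open>enat\<close> and the value \<open>\<infinity>\<close> make the definition independent of it.\<close>

definition disc_sym :: "'a topology \<Rightarrow> enat" where
  "disc_sym X = (if finite (mu X) then enat (Max ({0} \<union> mu X)) else \<infinity>)"

end

theory Submission
  imports Defs "HOL-Number_Theory.Cong"
begin

text \<open>Let $p : X' \to X$ be the covering. There is a constant $B$, depending only on $p$, such that every
effective action of $(\<int>/r)^m$ on $X$ with $r > 0$ produces an effective action of $(\<int>/s)^m$ on
$X'$ for some $s$ with $r \<le> s B$. Along a sequence $r_i \to \infty$ the numbers $s_i$ tend to infinity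
as well, so $\mu(X) \<subseteq> \mu(X')$, and the inequality of the maxima follows. The constant comes from a
topological and a group-theoretic source.

A homeomorphism $g$ of $X$ lifts to $X'$ exactly when the coverings $p$ and $g \circ p$ are isomorphic.
A closed manifold has only finitely many $n$-sheeted coverings up to isomorphism, so two of
$p, g \circ p, g^2 \circ p, \dots$ with bounded exponents are isomorphic, and therefore some power $g^N$ lifts,
with $N$ independent of $g$ (lemma \<open>power_of_homeomorphism_lifts\<close>). The finiteness is proved without
fundamental groups. Every map from a closed box into the base lifts (lemma \<open>liftable_closed_box\<close>),
hence every covering is trivial over small connected open sets, chosen inside chart boxes. Finitely many
such sets $V$ cover $X$, and they can be chosen so small that two of them that meet lie in a common set of the
same kind (lemma \<open>closed_manifold_good_cover\<close>). Number the sheets over each $V$. Over $V \<inter> V'$, which may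
have infinitely many components, two numbered sheets agree everywhere or nowhere, because both extend to the
common larger set. The finite table saying which sheets agree therefore determines the covering
(lemma \<open>coverings_with_equal_gluing_isomorphic\<close>).

The lifts of the elements of $G = (\<int>/r)^m$ form a group $\Gamma$ acting effectively on $X'$, with a
homomorphism to $G$ whose image contains the $N$-th powers and whose kernel consists of deck
transformations; these are finitely many (lemma \<open>deck_transformations_finite\<close>). It remains to find a large
$(\<int>/s)^m$ in $\Gamma$ (lemma \<open>Zmod_power_in_finite_extension\<close>). If the kernel has $e$ elements, conjugation
by an element of $\Gamma$ permutes each coset of the kernel, as $G$ is abelian, so the $e!$-th powers of
lifts of generators commute. They define a homomorphism from $\<int>^m$ to $\Gamma$ with kernel $s L$,
where $L$ is a lattice that contains $e! \<int>^m$. A basis of $L$ (lemma \<open>int_lattice_basis\<close>) gives a map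
$\<int>^m \to L \to \Gamma$ with kernel $s \<int>^m$, that is, an embedding of $(\<int>/s)^m$.\<close>

section \<open>Lifts along covering maps\<close>

lemma covering_map_continuous: "covering_map E X q \<Longrightarrow> continuous_map E X q"
  by (simp add: covering_map_def)

lemma covering_map_image: "covering_map E X q \<Longrightarrow> q ` topspace E = topspace X"
  by (simp add: covering_map_def)

lemma covering_map_evenly:
  assumes "covering_map E X q" "x \<in> topspace X"
  obtains T \<V> where "x \<in> T" "openin X T" "\<Union>\<V> = {c \<in> topspace E. q c \<in> T}"
    "\<And>U. U \<in> \<V> \<Longrightarrow> openin E U" "pairwise disjnt \<V>"
    "\<And>U. U \<in> \<V> \<Longrightarrow> homeomorphic_map (subtopology E U) (subtopology X T) q"
proof -
  from assms obtain T \<V> where "x \<in> T \<and> openin X T \<and> \<Union>\<V> = {c \<in> topspace E. q c \<in> T} \<and>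
      (\<forall>U \<in> \<V>. openin E U) \<and> pairwise disjnt \<V> \<and>
      (\<forall>U \<in> \<V>. homeomorphic_map (subtopology E U) (subtopology X T) q)"
    unfolding covering_map_def by blast
  then show thesis
    by (intro that[of T \<V>]) simp_all
qed

lemma covering_map_locally_injective:
  assumes "covering_map E X q" "e \<in> topspace E"
  obtains U where "openin E U" "e \<in> U" "inj_on q U"
proof -
  have "q e \<in> topspace X"
    using assms covering_map_image by blast
  then obtain T \<V> where T: "q e \<in> T" "openin X T" "\<Union>\<V> = {c \<in> topspace E. q c \<in> T}"
    "\<And>U. U \<in> \<V> \<Longrightarrow> openin E U"
    "\<And>U. U \<in> \<V> \<Longrightarrow> homeomorphic_map (subtopology E U) (subtopology X T) q"
    by (rule covering_map_evenly[OF assms(1)]) blast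
  obtain U where U: "U \<in> \<V>" "e \<in> U"
    using T assms(2) by blast
  then have "openin E U" "inj_on q U"
    using T(4)[OF U(1)] homeomorphic_imp_injective_map[OF T(5)[OF U(1)]]
      openin_subset[OF T(4)[OF U(1)]] by (auto simp: inf.absorb2)
  then show thesis using that U by blast
qed

lemma covering_map_separates_fibre:
  assumes "covering_map E X q" "e \<in> topspace E" "e' \<in> topspace E" "q e = q e'" "e \<noteq> e'"
  obtains U U' where "openin E U" "e \<in> U" "openin E U'" "e' \<in> U'" "U \<inter> U' = {}"
proof -
  have "q e \<in> topspace X"
    using assms covering_map_image by blast
  then obtain T \<V> where T: "q e \<in> T" "openin X T" "\<Union>\<V> = {c \<in> topspace E. q c \<in> T}"
    "\<And>U. U \<in> \<V> \<Longrightarrow> openin E U" "pairwise disjnt \<V>"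
    "\<And>U. U \<in> \<V> \<Longrightarrow> homeomorphic_map (subtopology E U) (subtopology X T) q"
    by (rule covering_map_evenly[OF assms(1)]) blast
  obtain U U' where U: "U \<in> \<V>" "e \<in> U" "U' \<in> \<V>" "e' \<in> U'"
    using T(1,3) assms(2,3,4) by (metis (mono_tags, lifting) UnionE mem_Collect_eq)
  have "inj_on q U"
    using homeomorphic_imp_injective_map[OF T(6)[OF U(1)]] openin_subset[OF T(4)[OF U(1)]]
    by (auto simp: inf.absorb2)
  then have "U \<noteq> U'"
    using U assms by (auto dest: inj_onD)
  then have "U \<inter> U' = {}"
    using T(5) U by (auto simp: pairwise_def disjnt_def)
  then show thesis using that U T(4) by blast
qed

definition lift_of :: "'b topology \<Rightarrow> ('b \<Rightarrow> 'a) \<Rightarrow> 'c topology \<Rightarrow> ('c \<Rightarrow> 'a) \<Rightarrow> ('c \<Rightarrow> 'b) \<Rightarrow> bool" where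
  "lift_of E q Y u l \<longleftrightarrow> continuous_map Y E l \<and> (\<forall>y \<in> topspace Y. q (l y) = u y)"

text \<open>Lifts are required through every point of every fibre. For the inclusion of a connected set this says that the
covering is trivial over the set, without naming the sheets.\<close>

definition liftable :: "'b topology \<Rightarrow> ('b \<Rightarrow> 'a) \<Rightarrow> 'c topology \<Rightarrow> ('c \<Rightarrow> 'a) \<Rightarrow> bool" where
  "liftable E q Y u \<longleftrightarrow>
     (\<forall>y \<in> topspace Y. \<forall>e \<in> topspace E. q e = u y \<longrightarrow> (\<exists>l. lift_of E q Y u l \<and> l y = e))"

lemma lift_of_subtopology: "lift_of E q Y u l \<Longrightarrow> lift_of E q (subtopology Y S) u l"
  by (auto simp: lift_of_def continuous_map_from_subtopology)

lemma liftable_subset: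
  assumes "liftable E q (subtopology Y T) u" "S \<subseteq> T"
  shows "liftable E q (subtopology Y S) u"
proof -
  have eq: "subtopology Y S = subtopology (subtopology Y T) S"
    using assms by (simp add: subtopology_subtopology inf.absorb2)
  show ?thesis
    unfolding liftable_def
  proof (intro ballI impI)
    fix y e assume *: "y \<in> topspace (subtopology Y S)" "e \<in> topspace E" "q e = u y"
    then have "y \<in> topspace (subtopology Y T)"
      using assms(2) by auto
    then obtain l where "lift_of E q (subtopology Y T) u l" "l y = e"
      using assms(1) * unfolding liftable_def by blast
    then show "\<exists>l. lift_of E q (subtopology Y S) u l \<and> l y = e"
      unfolding eq by (blast intro: lift_of_subtopology)
  qed
qed

lemma liftable_compose:
  assumes hc: "continuous_map Y Z h" and "liftable E q Z u"
  shows "liftable E q Y (u \<circ> h)"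
  unfolding liftable_def
proof (intro ballI impI)
  fix y e assume *: "y \<in> topspace Y" "e \<in> topspace E" "q e = (u \<circ> h) y"
  have hy: "h y \<in> topspace Z"
    using continuous_map_funspace[OF hc] * by auto
  then obtain l where l: "lift_of E q Z u l" "l (h y) = e"
    using assms(2) * unfolding liftable_def by auto
  have "lift_of E q Y (u \<circ> h) (l \<circ> h)"
    using l(1) continuous_map_compose[OF hc, of E l] continuous_map_funspace[OF hc]
    unfolding lift_of_def by auto
  then show "\<exists>l. lift_of E q Y (u \<circ> h) l \<and> l y = e"
    using l by (intro exI[of _ "l \<circ> h"]) auto
qed

lemma openin_lift_agreement:
  assumes cov: "covering_map E X q"
    and l: "lift_of E q Y u l" and l': "lift_of E q Y u l'"
  shows "openin Y {y \<in> topspace Y. l y = l' y}"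
proof (subst openin_subopen, intro ballI)
  let ?A = "{y \<in> topspace Y. l y = l' y}"
  have c: "continuous_map Y E l" "continuous_map Y E l'"
    and q: "\<And>y. y \<in> topspace Y \<Longrightarrow> q (l y) = q (l' y)"
    using l l' by (auto simp: lift_of_def)
  fix y assume y: "y \<in> ?A"
  then have "l y \<in> topspace E"
    using continuous_map_funspace[OF c(1)] by blast
  then obtain U where U: "openin E U" "l y \<in> U" "inj_on q U"
    by (rule covering_map_locally_injective[OF cov])
  let ?O = "{y \<in> topspace Y. l y \<in> U} \<inter> {y \<in> topspace Y. l' y \<in> U}"
  have "openin Y ?O"
    using c U(1) by (intro openin_Int openin_continuous_map_preimage)
  moreover have "y \<in> ?O"
    using y U(2) by auto
  moreover have "?O \<subseteq> ?A"
    using U(3) q by (auto simp: inj_on_def)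
  ultimately show "\<exists>T. openin Y T \<and> y \<in> T \<and> T \<subseteq> ?A"
    by blast
qed

lemma openin_lift_disagreement:
  assumes cov: "covering_map E X q"
    and l: "lift_of E q Y u l" and l': "lift_of E q Y u l'"
  shows "openin Y {y \<in> topspace Y. l y \<noteq> l' y}"
proof (subst openin_subopen, intro ballI)
  let ?A = "{y \<in> topspace Y. l y \<noteq> l' y}"
  have c: "continuous_map Y E l" "continuous_map Y E l'"
    and q: "\<And>y. y \<in> topspace Y \<Longrightarrow> q (l y) = q (l' y)"
    using l l' by (auto simp: lift_of_def)
  fix y assume y: "y \<in> ?A"
  then have ly: "l y \<in> topspace E" "l' y \<in> topspace E" "q (l y) = q (l' y)" "l y \<noteq> l' y"
    using continuous_map_funspace[OF c(1)] continuous_map_funspace[OF c(2)] q by blast+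
  obtain U U' where U: "openin E U" "l y \<in> U" "openin E U'" "l' y \<in> U'" "U \<inter> U' = {}"
    by (rule covering_map_separates_fibre[OF cov ly])
  let ?O = "{y \<in> topspace Y. l y \<in> U} \<inter> {y \<in> topspace Y. l' y \<in> U'}"
  have "openin Y ?O"
    using c U(1,3) by (intro openin_Int openin_continuous_map_preimage)
  moreover have "y \<in> ?O"
    using y U(2,4) by auto
  moreover have "?O \<subseteq> ?A"
    using U(5) by auto
  ultimately show "\<exists>T. openin Y T \<and> y \<in> T \<and> T \<subseteq> ?A"
    by blast
qed

text \<open>The points where two lifts agree form an open set because a covering map is locally injective, and
the complement is open because distinct points of one fibre have disjoint neighbourhoods.\<close>

lemma lift_unique:
  assumes cov: "covering_map E X q" and conn: "connected_space Y"
    and l: "lift_of E q Y u l" and l': "lift_of E q Y u l'"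
    and y: "y \<in> topspace Y" "l y = l' y" and z: "z \<in> topspace Y"
  shows "l z = l' z"
proof -
  let ?A = "{y \<in> topspace Y. l y = l' y}"
  have "topspace Y - ?A = {y \<in> topspace Y. l y \<noteq> l' y}"
    by blast
  then have "closedin Y ?A"
    using openin_lift_disagreement[OF cov l l'] by (auto simp: closedin_def)
  then have "?A = topspace Y"
    using openin_lift_agreement[OF cov l l'] conn y unfolding connected_space_clopen_in by blast
  then show ?thesis using z by blast
qed

lemma covering_map_locally_liftable:
  assumes cov: "covering_map E X q" and x: "x \<in> topspace X"
  obtains T where "openin X T" "x \<in> T" "liftable E q (subtopology X T) (\<lambda>x. x)"
proof -
  obtain T \<V> where T: "x \<in> T" "openin X T" "\<Union>\<V> = {c \<in> topspace E. q c \<in> T}"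
    "\<And>U. U \<in> \<V> \<Longrightarrow> openin E U"
    "\<And>U. U \<in> \<V> \<Longrightarrow> homeomorphic_map (subtopology E U) (subtopology X T) q"
    by (rule covering_map_evenly[OF cov x]) blast
  have TX: "T \<subseteq> topspace X" using T(2) by (rule openin_subset)
  have "\<exists>l. lift_of E q (subtopology X T) (\<lambda>x. x) l \<and> l y = e"
    if e: "e \<in> topspace E" "q e = y" "y \<in> T" for y e
  proof -
    obtain U where U: "U \<in> \<V>" "e \<in> U" using T(3) e by blast
    have UE: "U \<subseteq> topspace E" using T(4)[OF U(1)] by (rule openin_subset)
    obtain k where "homeomorphic_maps (subtopology E U) (subtopology X T) q k"
      using T(5)[OF U(1)] by (auto simp: homeomorphic_map_maps)
    then have k: "continuous_map (subtopology X T) E k" "\<And>x. x \<in> T \<Longrightarrow> q (k x) = x"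
       "\<And>c. c \<in> U \<Longrightarrow> k (q c) = c"
      using UE TX by (auto simp: homeomorphic_maps_def continuous_map_in_subtopology inf.absorb2)
    then show ?thesis
      using U e by (intro exI[of _ k]) (auto simp: lift_of_def)
  qed
  then have "liftable E q (subtopology X T) (\<lambda>x. x)"
    by (auto simp: liftable_def)
  then show thesis using that T by blast
qed

lemma locally_liftable:
  assumes cov: "covering_map E X q" and u: "continuous_map Y X u" and y: "y \<in> topspace Y"
  obtains T where "openin Y T" "y \<in> T" "liftable E q (subtopology Y T) u"
proof -
  have "u y \<in> topspace X" using u y by (auto simp: continuous_map_def)
  then obtain T where T: "openin X T" "u y \<in> T" "liftable E q (subtopology X T) (\<lambda>x. x)"
    by (rule covering_map_locally_liftable[OF cov])
  let ?O = "{y \<in> topspace Y. u y \<in> T}"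
  have O: "openin Y ?O" using u T(1) by (rule openin_continuous_map_preimage)
  have uO: "continuous_map (subtopology Y ?O) (subtopology X T) u"
    by (rule continuous_map_into_subtopology[OF continuous_map_from_subtopology[OF u]]) simp
  have "liftable E q (subtopology Y ?O) ((\<lambda>x. x) \<circ> u)"
    using uO T(3) by (rule liftable_compose)
  then have "liftable E q (subtopology Y ?O) u"
    by (simp add: comp_def)
  moreover have "y \<in> ?O"
    using T(2) y by simp
  ultimately show thesis
    using O by (intro that[of ?O])
qed

lemma continuous_map_glue_closed:
  assumes S: "closedin Y S" and T: "closedin Y T"
    and l: "continuous_map (subtopology Y S) E l" and m: "continuous_map (subtopology Y T) E m"
    and agree: "\<And>w. w \<in> S \<Longrightarrow> w \<in> T \<Longrightarrow> l w = m w"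
  shows "continuous_map (subtopology Y (S \<union> T)) E (\<lambda>w. if w \<in> S then l w else m w)"
proof -
  let ?Z = "subtopology Y (S \<union> T)"
  have Z: "subtopology ?Z S = subtopology Y S" "subtopology ?Z T = subtopology Y T"
    by (simp_all add: subtopology_subtopology inf_sup_absorb)
  have clo: "closedin ?Z S" "closedin ?Z T"
    using S T by (simp_all add: closedin_subset_topspace)
  let ?T = "\<lambda>b::bool. if b then S else T" and ?f = "\<lambda>b::bool. if b then l else m"
  show ?thesis
  proof (rule pasting_lemma_closed[of "UNIV :: bool set" ?Z ?T E ?f])
    show "finite (UNIV :: bool set)" by simp
    show "closedin ?Z (?T i)" for i using clo by simp
    show "continuous_map (subtopology ?Z (?T i)) E (?f i)" for i using l m Z by (cases i) simp_all
    fix i j x assume "x \<in> topspace ?Z \<inter> ?T i \<inter> ?T j"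
    then show "?f i x = ?f j x" using agree by (cases i; cases j) simp_all
  next
    fix x assume "x \<in> topspace ?Z"
    then show "\<exists>j. j \<in> UNIV \<and> x \<in> ?T j \<and> (if x \<in> S then l x else m x) = ?f j x"
      by (intro exI[of _ "x \<in> S"]) auto
  qed
qed

text \<open>A lift over one piece is continued over the other from a point of the intersection; as the intersection is
connected, the two lifts agree on all of it and paste together.\<close>

lemma liftable_Un:
  assumes cov: "covering_map E X q"
    and S: "closedin Y S" "liftable E q (subtopology Y S) u"
    and T: "closedin Y T" "liftable E q (subtopology Y T) u"
    and ST: "connectedin Y (S \<inter> T)" "S \<inter> T \<noteq> {}"
  shows "liftable E q (subtopology Y (S \<union> T)) u"
proof -
  have *: "\<exists>l. lift_of E q (subtopology Y (S \<union> T)) u l \<and> l y = e"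
    if S: "closedin Y S" "liftable E q (subtopology Y S) u"
      and T: "closedin Y T" "liftable E q (subtopology Y T) u"
      and ST: "connectedin Y (S \<inter> T)" "S \<inter> T \<noteq> {}"
      and e: "y \<in> S" "e \<in> topspace E" "q e = u y" for S T y e
  proof -
    have sub: "S \<subseteq> topspace Y" "T \<subseteq> topspace Y" using S T closedin_subset by auto
    have tops: "topspace (subtopology Y S) = S" "topspace (subtopology Y T) = T"
      "topspace (subtopology Y (S \<inter> T)) = S \<inter> T"
      using sub by auto
    obtain l where l: "lift_of E q (subtopology Y S) u l" "l y = e"
      using S(2) e unfolding liftable_def tops by blast
    obtain z where z: "z \<in> S" "z \<in> T" using ST by blast
    have cl: "continuous_map (subtopology Y S) E l" and ql: "\<And>y. y \<in> S \<Longrightarrow> q (l y) = u y"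
      using l(1) unfolding lift_of_def tops by blast+
    have "l z \<in> topspace E"
      using continuous_map_funspace[OF cl] z unfolding tops by blast
    then obtain m where m: "lift_of E q (subtopology Y T) u m" "m z = l z"
      using T(2) z ql[OF z(1)] unfolding liftable_def tops by blast
    have cm: "continuous_map (subtopology Y T) E m" and qm: "\<And>y. y \<in> T \<Longrightarrow> q (m y) = u y"
      using m(1) unfolding lift_of_def tops by blast+
    have "lift_of E q (subtopology Y (S \<inter> T)) u l" "lift_of E q (subtopology Y (S \<inter> T)) u m"
      using lift_of_subtopology[OF l(1), of T] lift_of_subtopology[OF m(1), of S]
      by (simp_all add: subtopology_subtopology Int_commute)
    moreover have "connected_space (subtopology Y (S \<inter> T))"
      using ST by (simp add: connectedin_def)
    ultimately have agree: "l w = m w" if "w \<in> S" "w \<in> T" for w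
      using lift_unique[OF cov, of "subtopology Y (S \<inter> T)" u l m z w] m(2) z that
      unfolding tops by simp
    define g where "g w = (if w \<in> S then l w else m w)" for w
    have "continuous_map (subtopology Y (S \<union> T)) E g"
      unfolding g_def using S(1) T(1) cl cm agree by (rule continuous_map_glue_closed)
    then have "lift_of E q (subtopology Y (S \<union> T)) u g"
      using ql qm by (auto simp: lift_of_def g_def)
    then show ?thesis using l(2) e by (intro exI[of _ g]) (simp add: g_def)
  qed
  show ?thesis
    unfolding liftable_def
  proof (intro ballI impI)
    fix y e assume y: "y \<in> topspace (subtopology Y (S \<union> T))" "e \<in> topspace E" "q e = u y"
    then consider "y \<in> S" | "y \<in> T" by auto
    then show "\<exists>l. lift_of E q (subtopology Y (S \<union> T)) u l \<and> l y = e"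
    proof cases
      case 1 then show ?thesis using *[OF S T ST] y by blast
    next
      case 2 then show ?thesis using *[OF T S, of y e] ST y by (auto simp: Int_commute Un_commute)
    qed
  qed
qed

section \<open>Maps from boxes lift\<close>

text \<open>Written as a product of sets, so that closedness and connectedness are inherited from the product topology.\<close>

definition closed_box :: "nat \<Rightarrow> (nat \<Rightarrow> real) \<Rightarrow> (nat \<Rightarrow> real) \<Rightarrow> (nat \<Rightarrow> real) set" where
  "closed_box n a b = (\<Pi>\<^sub>E i\<in>UNIV. if i < n then {a i..b i} else {0})"

definition open_box :: "nat \<Rightarrow> (nat \<Rightarrow> real) \<Rightarrow> (nat \<Rightarrow> real) \<Rightarrow> (nat \<Rightarrow> real) set" where
  "open_box n a b = (\<Pi>\<^sub>E i\<in>UNIV. if i < n then {a i<..<b i} else {0})"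

lemma mem_closed_box:
  "x \<in> closed_box n a b \<longleftrightarrow> (\<forall>i<n. a i \<le> x i \<and> x i \<le> b i) \<and> (\<forall>i\<ge>n. x i = 0)"
  unfolding closed_box_def PiE_UNIV_domain Pi_iff
  by (simp split: if_splits) (meson leD leI)

lemma mem_open_box:
  "x \<in> open_box n a b \<longleftrightarrow> (\<forall>i<n. a i < x i \<and> x i < b i) \<and> (\<forall>i\<ge>n. x i = 0)"
  unfolding open_box_def PiE_UNIV_domain Pi_iff
  by (simp split: if_splits) (meson leD leI)

lemma closed_box_subset: "closed_box n a b \<subseteq> topspace (Euclidean_space n)"
  by (auto simp: mem_closed_box topspace_Euclidean_space)

lemma closedin_closed_box: "closedin (Euclidean_space n) (closed_box n a b)"
proof -
  have "closedin (powertop_real UNIV) (closed_box n a b)"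
    unfolding closed_box_def closedin_product_topology by simp
  then show ?thesis
    using closed_box_subset[of n a b]
    unfolding Euclidean_space_def by (intro closedin_subset_topspace) simp_all
qed

lemma connectedin_closed_box: "connectedin (Euclidean_space n) (closed_box n a b)"
proof -
  have "connectedin (powertop_real UNIV) (closed_box n a b)"
    unfolding closed_box_def connectedin_PiE by auto
  then show ?thesis
    using closed_box_subset[of n a b]
    unfolding Euclidean_space_def by (simp add: connectedin_subtopology)
qed

lemma connectedin_open_box: "connectedin (Euclidean_space n) (open_box n a b)"
proof -
  have "connectedin (powertop_real UNIV) (open_box n a b)"
    unfolding open_box_def connectedin_PiE by auto
  moreover have "open_box n a b \<subseteq> {x. \<forall>i\<ge>n. x i = 0}"
    by (auto simp: mem_open_box)
  ultimately show ?thesis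
    unfolding Euclidean_space_def by (simp add: connectedin_subtopology)
qed

lemma openin_open_box: "openin (Euclidean_space n) (open_box n a b)"
proof -
  let ?U = "\<Pi>\<^sub>E i\<in>UNIV. if i < n then {a i<..<b i} else UNIV"
  have "{i::nat. (if i < n then {a i<..<b i} else UNIV) \<noteq> UNIV} \<subseteq> {..<n}"
    by auto
  then have "finite {i::nat. (if i < n then {a i<..<b i} else UNIV) \<noteq> UNIV}"
    by (rule finite_subset) simp
  then have "openin (powertop_real UNIV) ?U"
    by (simp add: openin_PiE_gen)
  moreover have "open_box n a b = ?U \<inter> {x. \<forall>i\<ge>n. x i = 0}"
    unfolding set_eq_iff Int_iff mem_open_box PiE_UNIV_domain Pi_iff mem_Collect_eq
    by (auto split: if_splits)
  ultimately show ?thesis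
    unfolding Euclidean_space_def openin_subtopology by blast
qed

text \<open>Only the first \<open>n\<close> of the infinitely many coordinates vary, so a basic open set of the product topology
contains a cube around each of its points.\<close>

lemma openin_Euclidean_space_contains_box:
  assumes "openin (Euclidean_space n) W" "x \<in> W"
  obtains d where "d > 0"
    "\<And>y. y \<in> topspace (Euclidean_space n) \<Longrightarrow> (\<And>i. i < n \<Longrightarrow> \<bar>y i - x i\<bar> < d) \<Longrightarrow> y \<in> W"
proof -
  obtain V where V: "openin (powertop_real UNIV) V" "W = V \<inter> {x. \<forall>i\<ge>n. x i = 0}"
    using assms(1) unfolding Euclidean_space_def openin_subtopology by blast
  have "x \<in> V" using assms(2) V(2) by blast
  then obtain U where U: "\<And>i. open (U i)" "x \<in> Pi\<^sub>E UNIV U" "Pi\<^sub>E UNIV U \<subseteq> V"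
    using V(1) unfolding openin_product_topology_alt by (auto dest!: bspec[of V _ x])
  have "\<exists>d>0. \<forall>t. \<bar>t - x i\<bar> < d \<longrightarrow> t \<in> U i" for i
    using U(1)[of i] U(2) unfolding open_dist PiE_UNIV_domain by (auto simp: dist_real_def)
  then obtain d where d: "\<And>i. d i > 0" "\<And>i t. \<bar>t - x i\<bar> < d i \<Longrightarrow> t \<in> U i"
    by metis
  define e where "e = Min (insert 1 (d ` {..<n}))"
  have "e > 0"
    unfolding e_def using d(1) by (subst Min_gr_iff) auto
  moreover have "e \<le> d i" if "i < n" for i
    unfolding e_def using that by (intro Min_le) auto
  moreover have "y \<in> W" if y: "y \<in> topspace (Euclidean_space n)" "\<And>i. i < n \<Longrightarrow> \<bar>y i - x i\<bar> < d i" for y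
  proof -
    have "y i \<in> U i" for i
    proof (cases "i < n")
      case True
      then show ?thesis by (intro d(2) y(2))
    next
      case False
      then have "y i = x i"
        using y(1) assms(2) V(2) by (auto simp: topspace_Euclidean_space)
      then show ?thesis
        using d(1)[of i] by (intro d(2)) simp
    qed
    then have "y \<in> V"
      using U(3) unfolding PiE_UNIV_domain by blast
    then show ?thesis
      using y(1) V(2) by (simp add: topspace_Euclidean_space)
  qed
  ultimately show thesis
    by (intro that[of e]) (meson less_le_trans)+
qed

lemma closed_box_split:
  assumes "k < n" "c k \<le> t" "t \<le> c' k"
  shows "closed_box n c c' = closed_box n c (c'(k := t)) \<union> closed_box n (c(k := t)) c'" (is ?union)
    and "closed_box n c (c'(k := t)) \<inter> closed_box n (c(k := t)) c' =
      closed_box n (c(k := t)) (c'(k := t))" (is ?inter)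
proof -
  have "x \<in> closed_box n c c' \<longleftrightarrow> x \<in> closed_box n c (c'(k := t)) \<or> x \<in> closed_box n (c(k := t)) c'" for x
    using assms linorder_le_cases[of "x k" t] unfolding mem_closed_box fun_upd_apply
    by (smt (verit, best))
  then show ?union by blast
  have "x \<in> closed_box n c (c'(k := t)) \<and> x \<in> closed_box n (c(k := t)) c' \<longleftrightarrow>
      x \<in> closed_box n (c(k := t)) (c'(k := t))" for x
  proof -
    have "(c i \<le> x i \<and> x i \<le> (c'(k := t)) i) \<and> ((c(k := t)) i \<le> x i \<and> x i \<le> c' i) \<longleftrightarrow>
        (c(k := t)) i \<le> x i \<and> x i \<le> (c'(k := t)) i" for i
      using assms by (cases "i = k") auto
    then show ?thesis
      unfolding mem_closed_box by blast
  qed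
  then show ?inter by blast
qed

text \<open>Boxes that are small around a point lift because the covering is locally trivial. The induction on \<open>k\<close>
enlarges the first \<open>k\<close> sides to their full length, the other sides staying small around the
coordinates of a given point. In each step, Bolzano's bisection lemma is applied to the next coordinate: two
adjacent boxes meet in a common face, which is connected, so lifts over them can be glued.\<close>

lemma liftable_closed_box:
  assumes cov: "covering_map E X q"
    and u: "continuous_map (subtopology (Euclidean_space n) (closed_box n a b)) X u"
  shows "liftable E q (subtopology (Euclidean_space n) (closed_box n a b)) u"
proof (cases "closed_box n a b = {}")
  case True
  then show ?thesis by (simp add: liftable_def)
next
  case False
  then obtain x0 where x0: "x0 \<in> closed_box n a b" by blast
  define Y where "Y = subtopology (Euclidean_space n) (closed_box n a b)"
  have topY: "topspace Y = closed_box n a b"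
    using closed_box_subset[of n a b] by (auto simp: Y_def)
  have uY: "continuous_map Y X u" using u by (simp add: Y_def)
  define L where "L c c' \<longleftrightarrow> liftable E q (subtopology Y (closed_box n c c')) u" for c c'
  define near where "near k x d c c' \<longleftrightarrow>
      (\<forall>i. k \<le> i \<and> i < n \<longrightarrow> a i \<le> c i \<and> c i \<le> x i \<and> x i \<le> c' i \<and> c' i \<le> b i \<and> c' i - c i < d)"
    for k x d and c c' :: "nat \<Rightarrow> real"
  define full where "full k c c' \<longleftrightarrow> (\<forall>i<k. c i = a i \<and> c' i = b i)" for k and c c' :: "nat \<Rightarrow> real"
  have near_mono: "near k x d' c c'" if "near k x d c c'" "d \<le> d'" for k x d d' c c'
    using that unfolding near_def by fastforce
  have ab: "a i \<le> b i" if "i < n" for i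
    using x0 that unfolding mem_closed_box by force
  have glue: "L c c'"
    if k: "k < n" and full: "full k c c'" and near: "near (Suc k) x d c c'"
      and t: "a k \<le> c k" "c k \<le> t" "t \<le> c' k" "c' k \<le> b k"
      and L: "L c (c'(k := t))" "L (c(k := t)) c'" for k c c' x d t
  proof -
    have cc: "a i \<le> c i \<and> c i \<le> c' i \<and> c' i \<le> b i" if "i < n" for i
    proof -
      consider "i < k" | "i = k" | "Suc k \<le> i" by linarith
      then show ?thesis
      proof cases
        case 1 then show ?thesis using full ab[OF that] unfolding full_def by auto
      next
        case 2 then show ?thesis using t by auto
      next
        case 3 then show ?thesis using near that unfolding near_def by force
      qed
    qed
    have sub: "closed_box n c1 c2 \<subseteq> closed_box n a b"
      if "\<And>i. i < n \<Longrightarrow> a i \<le> c1 i \<and> c2 i \<le> b i" for c1 c2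
      using that unfolding subset_iff mem_closed_box by (meson order_trans)
    have clo: "closedin Y (closed_box n c1 c2)" if "closed_box n c1 c2 \<subseteq> closed_box n a b" for c1 c2
      unfolding Y_def using closedin_closed_box that by (rule closedin_subset_topspace)
    have con: "connectedin Y (closed_box n c1 c2)" if "closed_box n c1 c2 \<subseteq> closed_box n a b" for c1 c2
      unfolding Y_def using connectedin_closed_box that by (simp add: connectedin_subtopology)
    have "closed_box n c (c'(k := t)) \<subseteq> closed_box n a b" "closed_box n (c(k := t)) c' \<subseteq> closed_box n a b"
      "closed_box n (c(k := t)) (c'(k := t)) \<subseteq> closed_box n a b"
      using cc t by (auto intro!: sub)
    moreover have "(\<lambda>i. if i < n then (c(k := t)) i else 0) \<in> closed_box n (c(k := t)) (c'(k := t))"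
      using cc unfolding mem_closed_box by auto
    ultimately show ?thesis
      unfolding L_def closed_box_split(1)[of k n c t c', OF k t(2,3)]
      using L closed_box_split(2)[of k n c t c', OF k t(2,3)]
      unfolding L_def
      by (intro liftable_Un[OF cov] clo) (auto simp: con)
  qed
  have claim: "\<forall>x\<in>closed_box n a b. \<exists>d>0. \<forall>c c'. full k c c' \<and> near k x d c c' \<longrightarrow> L c c'" if "k \<le> n" for k
    using that
  proof (induction k)
    case 0
    show ?case
    proof
      fix x assume x: "x \<in> closed_box n a b"
      obtain T where T: "openin Y T" "x \<in> T" "liftable E q (subtopology Y T) u"
        using locally_liftable[OF cov uY, of x] x topY by metis
      obtain T' where T': "openin (Euclidean_space n) T'" "T = T' \<inter> closed_box n a b"
        using T(1) unfolding Y_def openin_subtopology by blast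
      obtain d where d: "d > 0" "\<And>y. y \<in> topspace (Euclidean_space n) \<Longrightarrow>
          (\<And>i. i < n \<Longrightarrow> \<bar>y i - x i\<bar> < d) \<Longrightarrow> y \<in> T'"
        using openin_Euclidean_space_contains_box[OF T'(1), of x] T(2) T'(2) by (metis IntD1)
      have "L c c'" if "near 0 x d c c'" for c c'
      proof -
        have "closed_box n c c' \<subseteq> T"
        proof
          fix y assume y: "y \<in> closed_box n c c'"
          have *: "a i \<le> y i \<and> y i \<le> b i \<and> \<bar>y i - x i\<bar> < d" if "i < n" for i
          proof -
            have "c i \<le> y i" "y i \<le> c' i" using y that unfolding mem_closed_box by blast+
            moreover have "a i \<le> c i \<and> c i \<le> x i \<and> x i \<le> c' i \<and> c' i \<le> b i \<and> c' i - c i < d"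
              using \<open>near 0 x d c c'\<close> that unfolding near_def by blast
            ultimately show ?thesis by linarith
          qed
          have "y \<in> T'"
            using * y closed_box_subset by (intro d(2)) blast+
          moreover have "y \<in> closed_box n a b"
            using * y unfolding mem_closed_box by blast
          ultimately show "y \<in> T" using T'(2) by blast
        qed
        then show ?thesis unfolding L_def using liftable_subset[OF T(3)] by blast
      qed
      then show "\<exists>d>0. \<forall>c c'. full 0 c c' \<and> near 0 x d c c' \<longrightarrow> L c c'"
        using d(1) by blast
    qed
  next
    case (Suc k)
    then have k: "k < n" by simp
    note IH = Suc.IH[OF less_imp_le[OF k]]
    show ?case
    proof
      fix x assume x: "x \<in> closed_box n a b"
      \<comment> \<open>The guards are there because Bolzano's lemma ranges over all intervals that contain a point, not only over subintervals of \<open>{a k..b k}\<close>.\<close>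
      define Q where "Q r s \<longleftrightarrow> (a k \<le> r \<longrightarrow> s \<le> b k \<longrightarrow>
          (\<exists>d>0. \<forall>c c'. full k c c' \<and> c k = r \<and> c' k = s \<and> near (Suc k) x d c c' \<longrightarrow> L c c'))" for r s
      have "Q (a k) (b k)"
        using ab[OF k]
      proof (induction rule: Bolzano)
        case (trans r s t)
        show ?case
          unfolding Q_def
        proof (intro impI)
          assume rt: "a k \<le> r" "t \<le> b k"
          obtain d1 where d1: "d1 > 0"
            "\<And>c c'. full k c c' \<and> c k = r \<and> c' k = s \<and> near (Suc k) x d1 c c' \<Longrightarrow> L c c'"
            using trans(1,4) rt unfolding Q_def by (meson order_trans)
          obtain d2 where d2: "d2 > 0"
            "\<And>c c'. full k c c' \<and> c k = s \<and> c' k = t \<and> near (Suc k) x d2 c c' \<Longrightarrow> L c c'"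
            using trans(2,3) rt unfolding Q_def by (meson order_trans)
          have "L c c'" if c: "full k c c'" "c k = r" "c' k = t" "near (Suc k) x (min d1 d2) c c'" for c c'
          proof (rule glue[OF k c(1,4), of s])
            have "full k c (c'(k := s))" "near (Suc k) x d1 c (c'(k := s))"
              using c(1) near_mono[OF c(4), of d1] by (auto simp: full_def near_def)
            then show "L c (c'(k := s))"
              using c(2) by (intro d1(2)) simp
            have "full k (c(k := s)) c'" "near (Suc k) x d2 (c(k := s)) c'"
              using c(1) near_mono[OF c(4), of d2] by (auto simp: full_def near_def)
            then show "L (c(k := s)) c'"
              using c(3) by (intro d2(2)) simp
          qed (use c rt trans(3,4) in simp_all)
          then show "\<exists>d>0. \<forall>c c'. full k c c' \<and> c k = r \<and> c' k = t \<and> near (Suc k) x d c c' \<longrightarrow> L c c'"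
            using d1(1) d2(1) by (intro exI[of _ "min d1 d2"]) simp
        qed
      next
        case (local t)
        have "x(k := t) \<in> closed_box n a b"
          using x local k unfolding mem_closed_box by simp
        then obtain d where d: "d > 0" "\<And>c c'. full k c c' \<and> near k (x(k := t)) d c c' \<Longrightarrow> L c c'"
          using IH by meson
        have "Q r s" if rs: "r \<le> t" "t \<le> s" "s - r < d" for r s
          unfolding Q_def
        proof (intro impI exI[of _ d] conjI allI)
          fix c c'
          assume r: "a k \<le> r" "s \<le> b k"
          assume c: "full k c c' \<and> c k = r \<and> c' k = s \<and> near (Suc k) x d c c'"
          have "near k (x(k := t)) d c c'"
            unfolding near_def
          proof (intro allI impI)
            fix i assume i: "k \<le> i \<and> i < n"
            show "a i \<le> c i \<and> c i \<le> (x(k := t)) i \<and> (x(k := t)) i \<le> c' i \<and> c' i \<le> b i \<and> c' i - c i < d"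
            proof (cases "i = k")
              case True then show ?thesis using r rs c by simp
            next
              case False
              then have "Suc k \<le> i" using i by simp
              then show ?thesis using c i False unfolding near_def by simp
            qed
          qed
          then show "L c c'" using c by (intro d(2)) simp
        qed (rule d(1))
        then show ?case using d(1) by blast
      qed
      then obtain d where d: "d > 0"
        "\<And>c c'. full k c c' \<and> c k = a k \<and> c' k = b k \<and> near (Suc k) x d c c' \<Longrightarrow> L c c'"
        unfolding Q_def by blast
      have "L c c'" if "full (Suc k) c c'" "near (Suc k) x d c c'" for c c'
        using that by (intro d(2)) (simp add: full_def)
      then show "\<exists>d>0. \<forall>c c'. full (Suc k) c c' \<and> near (Suc k) x d c c' \<longrightarrow> L c c'"
        using d(1) by blast
    qed
  qed
  have "L a b"
    using claim[OF order_refl] x0 unfolding full_def near_def by (metis linorder_not_le)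
  then show ?thesis
    unfolding L_def Y_def by (simp add: subtopology_subtopology)
qed

section \<open>Good covers of closed manifolds\<close>

text \<open>Connected open sets that sit inside the image of a closed box \<open>closed_box n a b\<close>: the map \<open>u\<close> parametrises
that image and \<open>k\<close> is the chart. All that matters below is that such sets form a base of a manifold and
that every covering is trivial over them; this form of the definition does not mention coverings, so one
set serves for all of them at once.\<close>

definition boxed :: "'a topology \<Rightarrow> 'a set \<Rightarrow> bool" where
  "boxed X V \<longleftrightarrow> openin X V \<and> connectedin X V \<and>
     (\<exists>n a b u k. continuous_map (subtopology (Euclidean_space n) (closed_box n a b)) X u \<and>
        continuous_map (subtopology X V) (subtopology (Euclidean_space n) (closed_box n a b)) k \<and>
        (\<forall>x\<in>V. u (k x) = x))"

lemma boxed_imp_openin: "boxed X V \<Longrightarrow> openin X V"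
  by (simp add: boxed_def)

lemma boxed_imp_subset: "boxed X V \<Longrightarrow> V \<subseteq> topspace X"
  by (simp add: boxed_def openin_subset)

lemma boxed_imp_connected: "boxed X V \<Longrightarrow> connected_space (subtopology X V)"
  by (simp add: boxed_def connectedin_def)

lemma liftable_cong:
  assumes "liftable E q Y u" "\<And>y. y \<in> topspace Y \<Longrightarrow> u y = u' y"
  shows "liftable E q Y u'"
  using assms by (simp add: liftable_def lift_of_def)

text \<open>The inclusion of \<open>V\<close> factors through a closed box, from which maps lift.\<close>

lemma boxed_imp_liftable:
  assumes cov: "covering_map E X q" and V: "boxed X V"
  shows "liftable E q (subtopology X V) (\<lambda>x. x)"
proof -
  obtain n a b u k where
    u: "continuous_map (subtopology (Euclidean_space n) (closed_box n a b)) X u" and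
    k: "continuous_map (subtopology X V) (subtopology (Euclidean_space n) (closed_box n a b)) k" and
    uk: "\<forall>x\<in>V. u (k x) = x"
    using V unfolding boxed_def by blast
  show ?thesis
    using liftable_compose[OF k liftable_closed_box[OF cov u]]
    by (rule liftable_cong) (use uk in simp)
qed

text \<open>The set is the preimage in a chart of an open box around the image of \<open>x\<close>; the corresponding closed box is small
enough to stay in the image of the chart.\<close>

lemma manifold_boxed_base:
  assumes X: "topological_manifold n X" and N: "openin X N" "x \<in> N"
  obtains V where "boxed X V" "x \<in> V" "V \<subseteq> N"
proof -
  have "x \<in> topspace X" using N openin_subset by blast
  then obtain U W where U: "openin X U" "x \<in> U" and W: "openin (Euclidean_space n) W"
    and "subtopology X U homeomorphic_space subtopology (Euclidean_space n) W"
    using X unfolding topological_manifold_def by blast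
  then obtain h g where "homeomorphic_maps (subtopology X U) (subtopology (Euclidean_space n) W) h g"
    unfolding homeomorphic_space_def by blast
  moreover have UX: "U \<subseteq> topspace X" and WE: "W \<subseteq> topspace (Euclidean_space n)"
    using U W openin_subset by blast+
  ultimately have h: "continuous_map (subtopology X U) (subtopology (Euclidean_space n) W) h"
    and g: "continuous_map (subtopology (Euclidean_space n) W) (subtopology X U) g"
    and gh: "\<And>z. z \<in> U \<Longrightarrow> g (h z) = z" and hg: "\<And>y. y \<in> W \<Longrightarrow> h (g y) = y"
    unfolding homeomorphic_maps_def by (simp_all add: inf.absorb2)
  have hW: "h z \<in> W" if "z \<in> U" for z
    using continuous_map_funspace[OF h] that UX WE by (auto simp: inf.absorb2)
  have gU: "g y \<in> U" if "y \<in> W" for y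
    using continuous_map_funspace[OF g] that UX WE by (auto simp: inf.absorb2)
  let ?O = "{y \<in> topspace (subtopology (Euclidean_space n) W). g y \<in> U \<inter> N}"
  have "openin (subtopology X U) (U \<inter> N)"
    using N(1) by (simp add: openin_subtopology_Int2)
  then have "openin (subtopology (Euclidean_space n) W) ?O"
    by (rule openin_continuous_map_preimage[OF g])
  then have O: "openin (Euclidean_space n) ?O"
    using W by (rule openin_trans_full)
  have hx: "h x \<in> ?O"
    using hW[OF U(2)] gh[OF U(2)] U(2) N(2) WE by auto
  obtain d where d: "d > 0" "\<And>y. y \<in> topspace (Euclidean_space n) \<Longrightarrow>
      (\<And>i. i < n \<Longrightarrow> \<bar>y i - h x i\<bar> < d) \<Longrightarrow> y \<in> ?O"
    using openin_Euclidean_space_contains_box[OF O hx] by blast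
  \<comment> \<open>Half the radius, so that the closed box still lies in the open set.\<close>
  define a b where "a = (\<lambda>i. h x i - d / 2)" and "b = (\<lambda>i. h x i + d / 2)"
  have boxO: "closed_box n a b \<subseteq> ?O"
  proof
    fix y assume y: "y \<in> closed_box n a b"
    show "y \<in> ?O"
    proof (rule d(2))
      show "y \<in> topspace (Euclidean_space n)"
        using y closed_box_subset by blast
      fix i assume "i < n"
      then have "a i \<le> y i" "y i \<le> b i"
        using y unfolding mem_closed_box by blast+
      then show "\<bar>y i - h x i\<bar> < d"
        using d(1) unfolding a_def b_def abs_less_iff by simp
    qed
  qed
  have open_closed: "open_box n a b \<subseteq> closed_box n a b"
    by (auto simp: mem_open_box mem_closed_box less_imp_le)
  have boxW: "closed_box n a b \<subseteq> W" and boxN: "\<And>y. y \<in> closed_box n a b \<Longrightarrow> g y \<in> N"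
    using boxO by auto
  define V where "V = {z \<in> topspace (subtopology X U). h z \<in> open_box n a b}"
  have VU: "V \<subseteq> U" by (auto simp: V_def)
  have "openin (subtopology (Euclidean_space n) W) (open_box n a b)"
    using openin_open_box boxW open_closed by (metis openin_subset_topspace_eq openin_open_subtopology W subset_trans)
  then have "openin (subtopology X U) V"
    unfolding V_def by (rule openin_continuous_map_preimage[OF h])
  then have oV: "openin X V"
    using U(1) by (rule openin_trans_full)
  have V_eq: "V = g ` open_box n a b"
  proof
    show "V \<subseteq> g ` open_box n a b"
      using gh by (force simp: V_def)
    show "g ` open_box n a b \<subseteq> V"
    proof
      fix z assume "z \<in> g ` open_box n a b"
      then obtain y where y: "z = g y" "y \<in> open_box n a b" by blast
      then have "y \<in> W" using boxW open_closed by blast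
      then show "z \<in> V"
        using gU[of y] hg[of y] y UX by (auto simp: V_def)
    qed
  qed
  have "connectedin (subtopology (Euclidean_space n) W) (open_box n a b)"
    using connectedin_open_box boxW open_closed by (auto simp: connectedin_subtopology)
  then have "connectedin (subtopology X U) V"
    unfolding V_eq by (rule connectedin_continuous_map_image[OF g])
  then have cV: "connectedin X V"
    by (simp add: connectedin_subtopology)
  have cg: "continuous_map (subtopology (Euclidean_space n) (closed_box n a b)) X g"
    using continuous_map_into_fulltopology[OF g] boxW by (rule continuous_map_from_subtopology_mono)
  have "continuous_map (subtopology X V) (Euclidean_space n) h"
    using continuous_map_into_fulltopology[OF h] VU by (rule continuous_map_from_subtopology_mono)
  then have ch: "continuous_map (subtopology X V) (subtopology (Euclidean_space n) (closed_box n a b)) h"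
    by (rule continuous_map_into_subtopology) (use open_closed in \<open>auto simp: V_def\<close>)
  have "boxed X V"
    unfolding boxed_def using oV cV cg ch gh VU by blast
  moreover have "x \<in> V"
    using U UX hW[OF U(2)] WE d(1) by (auto simp: V_def mem_open_box a_def b_def topspace_Euclidean_space)
  moreover have "V \<subseteq> N"
    unfolding V_eq using boxN open_closed by auto
  ultimately show thesis by (rule that)
qed

text \<open>The last clause is what makes the comparison of sheets over an overlap possible although the overlap itself
need not be connected.\<close>

definition good_cover :: "'a topology \<Rightarrow> 'a set set \<Rightarrow> bool" where
  "good_cover X \<V> \<longleftrightarrow> finite \<V> \<and> \<Union>\<V> = topspace X \<and> (\<forall>V\<in>\<V>. boxed X V \<and> V \<noteq> {}) \<and>
     (\<forall>V\<in>\<V>. \<forall>V'\<in>\<V>. V \<inter> V' \<noteq> {} \<longrightarrow> (\<exists>W. boxed X W \<and> V \<union> V' \<subseteq> W))"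

text \<open>Choose finitely many boxed sets \<open>W s\<close> that contain closed sets \<open>C s\<close> whose interiors already cover. A
neighbourhood \<open>N x\<close> of \<open>x\<close> is small enough if it lies in \<open>W s\<close> whenever \<open>x\<close> is in \<open>C s\<close> and misses
\<open>C s\<close> otherwise: a point \<open>z\<close> common to subsets of \<open>N x\<close> and \<open>N y\<close> lies in some \<open>C s\<close>, so \<open>x\<close> and \<open>y\<close>
lie in it too, and both subsets are inside \<open>W s\<close>.\<close>

lemma closed_manifold_good_cover:
  assumes "closed_manifold X"
  obtains \<V> where "good_cover X \<V>"
proof -
  obtain n where n: "topological_manifold n X" and comp: "compact_space X"
    using assms by (auto simp: closed_manifold_def)
  have "Hausdorff_space X" using n by (simp add: topological_manifold_def)
  then have reg: "regular_space X"
    using comp compact_Hausdorff_imp_regular_space by blast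
  have finite_subcover: "\<exists>\<F>. finite \<F> \<and> \<F> \<subseteq> \<U> \<and> topspace X \<subseteq> \<Union>\<F>"
    if "\<forall>U\<in>\<U>. openin X U" "topspace X \<subseteq> \<Union>\<U>" for \<U>
    using comp that unfolding compact_space_alt by blast
  define R where "R x W O' C \<longleftrightarrow> boxed X W \<and> openin X O' \<and> closedin X C \<and> x \<in> O' \<and> O' \<subseteq> C \<and> C \<subseteq> W"
    for x W O' C
  have "\<forall>x\<in>topspace X. \<exists>W O' C. R x W O' C"
  proof
    fix x assume x: "x \<in> topspace X"
    obtain W where W: "boxed X W" "x \<in> W"
      by (rule manifold_boxed_base[OF n openin_topspace x])
    obtain O' C where "openin X O'" "closedin X C" "x \<in> O'" "O' \<subseteq> C" "C \<subseteq> W"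
      using reg boxed_imp_openin[OF W(1)] W(2) neighbourhood_base_of_closedin[of X]
      unfolding neighbourhood_base_of by meson
    then show "\<exists>W O' C. R x W O' C" unfolding R_def using W by blast
  qed
  from bchoice[OF this] obtain W where "\<forall>x\<in>topspace X. \<exists>O' C. R x (W x) O' C" by blast
  from bchoice[OF this] obtain O' where "\<forall>x\<in>topspace X. \<exists>C. R x (W x) (O' x) C" by blast
  from bchoice[OF this] obtain C where "\<forall>x\<in>topspace X. R x (W x) (O' x) (C x)" by blast
  then have WOC: "\<And>x. x \<in> topspace X \<Longrightarrow> boxed X (W x)"
    "\<And>x. x \<in> topspace X \<Longrightarrow> openin X (O' x)" "\<And>x. x \<in> topspace X \<Longrightarrow> closedin X (C x)"
    "\<And>x. x \<in> topspace X \<Longrightarrow> x \<in> O' x" "\<And>x. x \<in> topspace X \<Longrightarrow> O' x \<subseteq> C x"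
    "\<And>x. x \<in> topspace X \<Longrightarrow> C x \<subseteq> W x"
    unfolding R_def by simp_all
  have "\<forall>U\<in>O' ` topspace X. openin X U" "topspace X \<subseteq> \<Union>(O' ` topspace X)"
    using WOC(2,4) by auto
  from finite_subcover[OF this] obtain \<F> where
    \<F>: "finite \<F>" "\<F> \<subseteq> O' ` topspace X" "topspace X \<subseteq> \<Union>\<F>"
    by blast
  obtain S where S: "S \<subseteq> topspace X" "finite S" "\<F> = O' ` S"
    using finite_subset_image[OF \<F>(1,2)] by blast
  \<comment> \<open>A finite intersection of open sets, because \<open>S\<close> is finite.\<close>
  define N where "N x = topspace X \<inter> \<Inter>(W ` {s \<in> S. x \<in> C s}) \<inter> \<Inter>((\<lambda>s. topspace X - C s) ` {s \<in> S. x \<notin> C s})" for x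
  have N: "openin X (N x)" for x
  proof -
    have "openin X (topspace X \<inter> \<Inter>(W ` {s \<in> S. x \<in> C s}))"
      using S WOC(1) by (intro openin_Int_Inter) (auto intro: boxed_imp_openin)
    moreover have "openin X (topspace X \<inter> \<Inter>((\<lambda>s. topspace X - C s) ` {s \<in> S. x \<notin> C s}))"
      using S WOC(3) by (intro openin_Int_Inter) (auto simp: subset_iff)
    ultimately have "openin X ((topspace X \<inter> \<Inter>(W ` {s \<in> S. x \<in> C s})) \<inter>
        (topspace X \<inter> \<Inter>((\<lambda>s. topspace X - C s) ` {s \<in> S. x \<notin> C s})))"
      by (rule openin_Int)
    then show ?thesis
      unfolding N_def by (simp add: Int_ac)
  qed
  have "x \<in> N x" if "x \<in> topspace X" for x
    using that WOC(6) S(1) unfolding N_def by auto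
  then have "\<exists>V. boxed X V \<and> x \<in> V \<and> V \<subseteq> N x" if "x \<in> topspace X" for x
    using manifold_boxed_base[OF n N, of x x] that by blast
  then have "\<forall>x\<in>topspace X. \<exists>V. boxed X V \<and> x \<in> V \<and> V \<subseteq> N x"
    by blast
  from bchoice[OF this] obtain V where V: "\<And>x. x \<in> topspace X \<Longrightarrow> boxed X (V x)" "\<And>x. x \<in> topspace X \<Longrightarrow> x \<in> V x"
    "\<And>x. x \<in> topspace X \<Longrightarrow> V x \<subseteq> N x"
    by blast
  have "\<forall>U\<in>V ` topspace X. openin X U" "topspace X \<subseteq> \<Union>(V ` topspace X)"
    using V(1,2) boxed_imp_openin by auto
  from finite_subcover[OF this] obtain \<G> where
    \<G>: "finite \<G>" "\<G> \<subseteq> V ` topspace X" "topspace X \<subseteq> \<Union>\<G>"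
    by blast
  have "\<exists>W'. boxed X W' \<and> V x \<union> V y \<subseteq> W'"
    if xy: "x \<in> topspace X" "y \<in> topspace X" "V x \<inter> V y \<noteq> {}" for x y
  proof -
    obtain z where z: "z \<in> V x" "z \<in> V y" using xy by blast
    then have "z \<in> topspace X" using boxed_imp_subset[OF V(1)] xy by blast
    then obtain s where s: "s \<in> S" "z \<in> O' s" using \<F>(3) S(3) by blast
    then have zC: "z \<in> C s" and sX: "s \<in> topspace X" using WOC(5) S(1) by blast+
    have "V w \<subseteq> W s" if w: "w \<in> topspace X" "z \<in> V w" for w
    proof -
      have "w \<in> C s"
        using V(3)[OF w(1)] w(2) zC s(1) unfolding N_def by blast
      then show ?thesis
        using V(3)[OF w(1)] s(1) unfolding N_def by blast
    qed
    then show ?thesis using WOC(1)[OF sX] xy z by blast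
  qed
  then have star: "\<exists>W'. boxed X W' \<and> A \<union> B \<subseteq> W'" if "A \<in> \<G>" "B \<in> \<G>" "A \<inter> B \<noteq> {}" for A B
    using that \<G>(2) by blast
  have members: "boxed X A \<and> A \<noteq> {}" if "A \<in> \<G>" for A
    using that \<G>(2) V(1,2) by blast
  then have "\<Union>\<G> = topspace X"
    using \<G>(3) boxed_imp_subset by blast
  then have "good_cover X \<G>"
    unfolding good_cover_def using \<G>(1) star members by simp
  then show thesis by (rule that)
qed

section \<open>Labelled sheets\<close>

definition fibre :: "'b topology \<Rightarrow> ('b \<Rightarrow> 'a) \<Rightarrow> 'a \<Rightarrow> 'b set" where
  "fibre E q x = {e \<in> topspace E. q e = x}"

definition sheeted_covering :: "nat \<Rightarrow> 'b topology \<Rightarrow> 'a topology \<Rightarrow> ('b \<Rightarrow> 'a) \<Rightarrow> bool" where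
  "sheeted_covering n E X q \<longleftrightarrow> covering_map E X q \<and>
     (\<forall>x\<in>topspace X. finite (fibre E q x) \<and> card (fibre E q x) = n)"

lemma connected_space_locally_constant:
  assumes "connected_space X"
    and loc: "\<And>x. x \<in> topspace X \<Longrightarrow> \<exists>V. openin X V \<and> x \<in> V \<and> (\<forall>y\<in>V. P y \<longleftrightarrow> P x)"
    and "x \<in> topspace X" "y \<in> topspace X" "P x"
  shows "P y"
proof -
  let ?A = "{x \<in> topspace X. P x}"
  have "openin X ?A"
  proof (subst openin_subopen, intro ballI)
    fix x assume x: "x \<in> ?A"
    obtain V where V: "openin X V" "x \<in> V" "\<forall>y\<in>V. P y \<longleftrightarrow> P x"
      using loc[of x] x by blast
    have "V \<subseteq> ?A"
      using x openin_subset[OF V(1)] V(3) by blast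
    with V(1,2) show "\<exists>T. openin X T \<and> x \<in> T \<and> T \<subseteq> ?A"
      by blast
  qed
  moreover have "openin X (topspace X - ?A)"
  proof (subst openin_subopen, intro ballI)
    fix x assume x: "x \<in> topspace X - ?A"
    obtain V where V: "openin X V" "x \<in> V" "\<forall>y\<in>V. P y \<longleftrightarrow> P x"
      using loc[of x] x by blast
    have "V \<subseteq> topspace X - ?A"
      using x openin_subset[OF V(1)] V(3) by blast
    with V(1,2) show "\<exists>T. openin X T \<and> x \<in> T \<and> T \<subseteq> topspace X - ?A"
      by blast
  qed
  then have "closedin X ?A"
    by (auto simp: closedin_def)
  ultimately have "?A = {} \<or> ?A = topspace X"
    using assms(1) unfolding connected_space_clopen_in by blast
  then show ?thesis using assms(3-5) by blast
qed

lemma boxed_section: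
  assumes cov: "covering_map E X q" and V: "boxed X V" and e: "e \<in> topspace E" "q e \<in> V"
  obtains s where "lift_of E q (subtopology X V) (\<lambda>x. x) s" "s (q e) = e"
proof -
  have "q e \<in> topspace (subtopology X V)"
    using e(2) boxed_imp_subset[OF V] by auto
  then have "\<exists>s. lift_of E q (subtopology X V) (\<lambda>x. x) s \<and> s (q e) = e"
    using boxed_imp_liftable[OF cov V] e(1) unfolding liftable_def by blast
  then show thesis using that by blast
qed

lemma section_in_fibre:
  assumes "lift_of E q (subtopology X V) (\<lambda>x. x) s" "x \<in> V" "V \<subseteq> topspace X"
  shows "s x \<in> topspace E" "q (s x) = x" "s x \<in> fibre E q x"
proof -
  have x: "x \<in> topspace (subtopology X V)" using assms by auto
  then show *: "s x \<in> topspace E" "q (s x) = x"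
    using assms(1) continuous_map_funspace[of "subtopology X V" E s] unfolding lift_of_def by blast+
  then show "s x \<in> fibre E q x" by (simp add: fibre_def)
qed

lemma boxed_section_unique:
  assumes cov: "covering_map E X q" and V: "boxed X V"
    and s: "lift_of E q (subtopology X V) (\<lambda>x. x) s" and t: "lift_of E q (subtopology X V) (\<lambda>x. x) t"
    and xy: "x \<in> V" "s x = t x" "y \<in> V"
  shows "s y = t y"
  using xy boxed_imp_subset[OF V]
  by (intro lift_unique[OF cov boxed_imp_connected[OF V] s t, of x y]) auto

text \<open>Sections over a connected set correspond to the points of any one fibre, so a numbering of the fibre over
\<open>x0\<close> numbers the fibres over all of \<open>V\<close>.\<close>

lemma boxed_labelled_sections:
  assumes cov: "covering_map E X q" and V: "boxed X V" and x0: "x0 \<in> V"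
    and fin: "finite (fibre E q x0)" "card (fibre E q x0) = n"
  obtains s where "\<And>i. i < n \<Longrightarrow> lift_of E q (subtopology X V) (\<lambda>x. x) (s i)"
    "\<And>x. x \<in> V \<Longrightarrow> bij_betw (\<lambda>i. s i x) {..<n} (fibre E q x)"
proof -
  obtain \<beta> where \<beta>: "bij_betw \<beta> {..<n} (fibre E q x0)"
    using ex_bij_betw_nat_finite[OF fin(1)] fin(2) by (auto simp: lessThan_atLeast0)
  have "\<forall>i\<in>{..<n}. \<exists>s. lift_of E q (subtopology X V) (\<lambda>x. x) s \<and> s x0 = \<beta> i"
  proof
    fix i assume "i \<in> {..<n}"
    then have "\<beta> i \<in> fibre E q x0" using \<beta> bij_betwE by blast
    then have \<beta>i: "\<beta> i \<in> topspace E" "q (\<beta> i) = x0" by (auto simp: fibre_def)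
    obtain s where "lift_of E q (subtopology X V) (\<lambda>x. x) s" "s (q (\<beta> i)) = \<beta> i"
      by (rule boxed_section[OF cov V \<beta>i(1)]) (use \<beta>i x0 in auto)
    then show "\<exists>s. lift_of E q (subtopology X V) (\<lambda>x. x) s \<and> s x0 = \<beta> i"
      using \<beta>i(2) by blast
  qed
  from bchoice[OF this] obtain s where
    s: "\<And>i. i < n \<Longrightarrow> lift_of E q (subtopology X V) (\<lambda>x. x) (s i)" "\<And>i. i < n \<Longrightarrow> s i x0 = \<beta> i"
    by auto
  have VX: "V \<subseteq> topspace X" using V by (rule boxed_imp_subset)
  have "bij_betw (\<lambda>i. s i x) {..<n} (fibre E q x)" if x: "x \<in> V" for x
    unfolding bij_betw_def
  proof
    show "inj_on (\<lambda>i. s i x) {..<n}"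
    proof (rule inj_onI)
      fix i j assume ij: "i \<in> {..<n}" "j \<in> {..<n}" "s i x = s j x"
      then have "s i x0 = s j x0"
        by (intro boxed_section_unique[OF cov V s(1) s(1) x _ x0]) simp_all
      then show "i = j"
        using s(2) ij \<beta> by (auto simp: bij_betw_def inj_on_def)
    qed
    show "(\<lambda>i. s i x) ` {..<n} = fibre E q x"
    proof
      show "(\<lambda>i. s i x) ` {..<n} \<subseteq> fibre E q x"
        using section_in_fibre(3)[OF s(1) x VX] by auto
      show "fibre E q x \<subseteq> (\<lambda>i. s i x) ` {..<n}"
      proof
        fix e assume e: "e \<in> fibre E q x"
        then have eq: "e \<in> topspace E" "q e = x" by (auto simp: fibre_def)
        obtain t where t: "lift_of E q (subtopology X V) (\<lambda>x. x) t" "t (q e) = e"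
          by (rule boxed_section[OF cov V eq(1)]) (use eq x in auto)
        have "t x0 \<in> fibre E q x0"
          using section_in_fibre(3)[OF t(1) x0 VX] .
        then obtain i where i: "i < n" "t x0 = s i x0"
          using \<beta> s(2) unfolding bij_betw_def by (metis imageE lessThan_iff)
        have "t x = s i x"
          using boxed_section_unique[OF cov V t(1) s(1)[OF i(1)] x0 i(2) x] .
        then have "e = s i x"
          using t(2) eq(2) by simp
        then show "e \<in> (\<lambda>i. s i x) ` {..<n}"
          using i(1) by blast
      qed
    qed
  qed
  with s(1) show thesis by (rule that)
qed

text \<open>Over a boxed set the labelled sections identify all fibres, so the number of points in a fibre is locally
constant.\<close>

lemma sheeted_covering_exists:
  assumes X: "closed_manifold X" "connected_space X" and p: "finite_covering_map E X p"
  obtains n where "sheeted_covering n E X p"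
proof (cases "topspace X = {}")
  case True
  then show thesis
    using p by (intro that[of 0]) (auto simp: sheeted_covering_def finite_covering_map_def)
next
  case False
  then obtain x0 where x0: "x0 \<in> topspace X" by blast
  obtain m where m: "topological_manifold m X"
    using X(1) by (auto simp: closed_manifold_def)
  have cov: "covering_map E X p" and fin: "\<And>x. x \<in> topspace X \<Longrightarrow> finite (fibre E p x)"
    using p by (auto simp: finite_covering_map_def fibre_def)
  define n where "n = card (fibre E p x0)"
  have "card (fibre E p x) = n" if "x \<in> topspace X" for x
  proof (rule connected_space_locally_constant[OF X(2) _ x0 that, where P = "\<lambda>x. card (fibre E p x) = n"])
    fix x assume x: "x \<in> topspace X"
    obtain V where V: "boxed X V" "x \<in> V"
      by (rule manifold_boxed_base[OF m openin_topspace x])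
    obtain s where "\<And>i. i < card (fibre E p x) \<Longrightarrow> lift_of E p (subtopology X V) (\<lambda>x. x) (s i)"
      and s: "\<And>y. y \<in> V \<Longrightarrow> bij_betw (\<lambda>i. s i y) {..<card (fibre E p x)} (fibre E p y)"
      by (rule boxed_labelled_sections[OF cov V fin[OF x] refl]) (rule that)
    show "\<exists>V. openin X V \<and> x \<in> V \<and> (\<forall>y\<in>V. (card (fibre E p y) = n) = (card (fibre E p x) = n))"
    proof (intro exI[of _ V] conjI ballI)
      fix y assume "y \<in> V"
      then have "card (fibre E p y) = card (fibre E p x)"
        using bij_betw_same_card[OF s] by simp
      then show "(card (fibre E p y) = n) = (card (fibre E p x) = n)"
        by simp
    qed (use V boxed_imp_openin[OF V(1)] in simp_all)
  qed (simp add: n_def)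
  then show thesis
    using cov fin by (intro that[of n]) (simp add: sheeted_covering_def)
qed

lemma covering_map_compose_homeomorphic:
  assumes cov: "covering_map E X p" and g: "homeomorphic_map X X g"
  shows "covering_map E X (g \<circ> p)"
proof -
  obtain h where h: "homeomorphic_maps X X g h" using g by (auto simp: homeomorphic_map_maps)
  then have ch: "continuous_map X X h" and hg: "\<And>x. x \<in> topspace X \<Longrightarrow> h (g x) = x"
    and gh: "\<And>x. x \<in> topspace X \<Longrightarrow> g (h x) = x"
    by (auto simp: homeomorphic_maps_def)
  have hX: "\<And>x. x \<in> topspace X \<Longrightarrow> h x \<in> topspace X"
    using continuous_map_funspace[OF ch] by blast
  have im: "(g \<circ> p) ` topspace E = topspace X"
    using covering_map_image[OF cov] homeomorphic_imp_surjective_map[OF g] by (simp only: image_comp[symmetric])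
  have pE: "\<And>e. e \<in> topspace E \<Longrightarrow> p e \<in> topspace X"
    using covering_map_image[OF cov] by blast
  have "\<exists>T. x \<in> T \<and> openin X T \<and>
        (\<exists>\<V>. \<Union>\<V> = {c \<in> topspace E. (g \<circ> p) c \<in> T} \<and> (\<forall>U \<in> \<V>. openin E U) \<and> pairwise disjnt \<V> \<and>
             (\<forall>U \<in> \<V>. homeomorphic_map (subtopology E U) (subtopology X T) (g \<circ> p)))"
    if x: "x \<in> topspace X" for x
  proof -
    obtain T \<V> where T: "h x \<in> T" "openin X T" "\<Union>\<V> = {c \<in> topspace E. p c \<in> T}"
      "\<And>U. U \<in> \<V> \<Longrightarrow> openin E U" "pairwise disjnt \<V>"
      "\<And>U. U \<in> \<V> \<Longrightarrow> homeomorphic_map (subtopology E U) (subtopology X T) p"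
      by (rule covering_map_evenly[OF cov hX[OF x]]) blast
    have TX: "T \<subseteq> topspace X" using T(2) by (rule openin_subset)
    have o: "openin X (g ` T)"
      using homeomorphic_map_openness[OF g TX] T(2) by simp
    have xT: "x \<in> g ` T"
      using T(1) gh[OF x] by force
    have inv: "g y \<in> g ` T \<longleftrightarrow> y \<in> T" if "y \<in> topspace X" for y
      using hg that TX by (metis image_iff subsetD)
    have pre: "\<Union>\<V> = {c \<in> topspace E. (g \<circ> p) c \<in> g ` T}"
      unfolding T(3) using inv pE by auto
    have gT: "homeomorphic_map (subtopology X T) (subtopology X (g ` T)) g"
      by (rule homeomorphic_map_subtopologies[OF g]) (use homeomorphic_imp_surjective_map[OF g] TX in auto)
    have "homeomorphic_map (subtopology E U) (subtopology X (g ` T)) (g \<circ> p)" if "U \<in> \<V>" for U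
      using homeomorphic_map_compose[OF T(6)[OF that] gT] .
    then show ?thesis
      using o xT pre T(4,5) by (intro exI[of _ "g ` T"] conjI exI[of _ \<V>] ballI) simp_all
  qed
  moreover have "continuous_map E X (g \<circ> p)"
    using covering_map_continuous[OF cov] homeomorphic_imp_continuous_map[OF g] by (rule continuous_map_compose)
  ultimately show ?thesis
    unfolding covering_map_def using im by blast
qed

lemma sheeted_covering_compose_homeomorphic:
  assumes p: "sheeted_covering n E X p" and g: "homeomorphic_map X X g"
  shows "sheeted_covering n E X (g \<circ> p)"
proof -
  have cov: "covering_map E X p" using p by (simp add: sheeted_covering_def)
  have pE: "\<And>e. e \<in> topspace E \<Longrightarrow> p e \<in> topspace X"
    using covering_map_image[OF cov] by blast
  have inj: "inj_on g (topspace X)" and sur: "g ` topspace X = topspace X"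
    using homeomorphic_imp_injective_map[OF g] homeomorphic_imp_surjective_map[OF g] by simp_all
  have "finite (fibre E (g \<circ> p) x) \<and> card (fibre E (g \<circ> p) x) = n" if x: "x \<in> topspace X" for x
  proof -
    obtain y where y: "y \<in> topspace X" "x = g y" using sur x by blast
    have "fibre E (g \<circ> p) x = fibre E p y"
      using y pE inj unfolding fibre_def by (auto dest: inj_onD)
    then show ?thesis using p y by (simp add: sheeted_covering_def)
  qed
  then show ?thesis
    using covering_map_compose_homeomorphic[OF cov g] by (simp add: sheeted_covering_def)
qed

section \<open>Coverings are determined by finite gluing data\<close>

text \<open>The numbering of the sheets over \<open>V\<close> is arbitrary but fixed once for each covering, so that the gluing data
below are a function of the covering.\<close>

definition sheet :: "nat \<Rightarrow> 'b topology \<Rightarrow> 'a topology \<Rightarrow> ('b \<Rightarrow> 'a) \<Rightarrow> 'a set \<Rightarrow> nat \<Rightarrow> 'a \<Rightarrow> 'b" where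
  "sheet n E X q V = (SOME s. (\<forall>i<n. lift_of E q (subtopology X V) (\<lambda>x. x) (s i)) \<and>
     (\<forall>x\<in>V. bij_betw (\<lambda>i. s i x) {..<n} (fibre E q x)))"

lemma sheet_properties:
  assumes q: "sheeted_covering n E X q" and V: "boxed X V" "V \<noteq> {}"
  shows "i < n \<Longrightarrow> lift_of E q (subtopology X V) (\<lambda>x. x) (sheet n E X q V i)"
    and "x \<in> V \<Longrightarrow> bij_betw (\<lambda>i. sheet n E X q V i x) {..<n} (fibre E q x)"
proof -
  let ?P = "\<lambda>s. (\<forall>i<n. lift_of E q (subtopology X V) (\<lambda>x. x) (s i)) \<and>
     (\<forall>x\<in>V. bij_betw (\<lambda>i. s i x) {..<n} (fibre E q x))"
  obtain x0 where x0: "x0 \<in> V" using V(2) by blast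
  then have "x0 \<in> topspace X" using boxed_imp_subset[OF V(1)] by blast
  then have cov: "covering_map E X q" and fin: "finite (fibre E q x0)" "card (fibre E q x0) = n"
    using q by (simp_all add: sheeted_covering_def)
  obtain s where s: "\<And>i. i < n \<Longrightarrow> lift_of E q (subtopology X V) (\<lambda>x. x) (s i)"
    "\<And>x. x \<in> V \<Longrightarrow> bij_betw (\<lambda>i. s i x) {..<n} (fibre E q x)"
    by (rule boxed_labelled_sections[OF cov V(1) x0 fin]) (rule that)
  then have "?P s" by simp
  then have "?P (sheet n E X q V)"
    unfolding sheet_def by (rule someI[where P = ?P])
  then show "i < n \<Longrightarrow> lift_of E q (subtopology X V) (\<lambda>x. x) (sheet n E X q V i)"
    and "x \<in> V \<Longrightarrow> bij_betw (\<lambda>i. sheet n E X q V i x) {..<n} (fibre E q x)"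
    by simp_all
qed

lemma good_coverD:
  assumes "good_cover X \<V>"
  shows "finite \<V>" "\<Union>\<V> = topspace X" "V \<in> \<V> \<Longrightarrow> boxed X V" "V \<in> \<V> \<Longrightarrow> V \<noteq> {}"
    "V \<in> \<V> \<Longrightarrow> V' \<in> \<V> \<Longrightarrow> V \<inter> V' \<noteq> {} \<Longrightarrow> \<exists>W. boxed X W \<and> V \<union> V' \<subseteq> W"
  using assms unfolding good_cover_def by simp_all

text \<open>The combinatorial record of a covering: which numbered sheets over two members of the cover coincide
somewhere, and hence everywhere, over their intersection.\<close>

definition gluing :: "nat \<Rightarrow> 'a topology \<Rightarrow> 'a set set \<Rightarrow> 'b topology \<Rightarrow> ('b \<Rightarrow> 'a) \<Rightarrow>
    (('a set \<times> nat) \<times> 'a set \<times> nat) set" where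
  "gluing n X \<V> E q = {((V, i), (V', j)) |V i V' j. V \<in> \<V> \<and> i < n \<and> V' \<in> \<V> \<and> j < n \<and>
     (\<exists>x\<in>V \<inter> V'. sheet n E X q V i x = sheet n E X q V' j x)}"

lemma gluing_in_Pow: "gluing n X \<V> E q \<in> Pow ((\<V> \<times> {..<n}) \<times> (\<V> \<times> {..<n}))"
  by (auto simp: gluing_def)

text \<open>Both sheets extend to the same sheet over a boxed set that contains \<open>V\<close> and \<open>V'\<close>.\<close>

lemma sheets_agree_on_overlap:
  assumes \<V>: "good_cover X \<V>" and q: "sheeted_covering n E X q"
    and V: "V \<in> \<V>" "i < n" and V': "V' \<in> \<V>" "j < n"
    and z: "z \<in> V \<inter> V'" "sheet n E X q V i z = sheet n E X q V' j z" and w: "w \<in> V \<inter> V'"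
  shows "sheet n E X q V i w = sheet n E X q V' j w"
proof -
  let ?s = "sheet n E X q V i" and ?t = "sheet n E X q V' j"
  have cov: "covering_map E X q" using q by (simp add: sheeted_covering_def)
  have bV: "boxed X V" "V \<noteq> {}" and bV': "boxed X V'" "V' \<noteq> {}"
    using \<V> V V' by (simp_all add: good_cover_def)
  have s: "lift_of E q (subtopology X V) (\<lambda>x. x) ?s" and t: "lift_of E q (subtopology X V') (\<lambda>x. x) ?t"
    using sheet_properties(1)[OF q bV V(2)] sheet_properties(1)[OF q bV' V'(2)] .
  obtain W where W: "boxed X W" "V \<union> V' \<subseteq> W"
    using good_coverD(5)[OF \<V> V(1) V'(1)] z(1) by blast
  have sz: "?s z \<in> topspace E" "q (?s z) = z"
    using section_in_fibre[OF s _ boxed_imp_subset[OF bV(1)]] z(1) by simp_all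
  obtain r where r: "lift_of E q (subtopology X W) (\<lambda>x. x) r" "r (q (?s z)) = ?s z"
    by (rule boxed_section[OF cov W(1) sz(1)]) (use sz z(1) W(2) in auto)
  have rV: "lift_of E q (subtopology X V) (\<lambda>x. x) r" and rV': "lift_of E q (subtopology X V') (\<lambda>x. x) r"
    using lift_of_subtopology[OF r(1), of V] lift_of_subtopology[OF r(1), of V'] W(2)
    by (simp_all add: subtopology_subtopology inf.absorb2)
  have "r w = ?s w"
    using boxed_section_unique[OF cov bV(1) rV s, of z w] z(1) w r(2) sz(2) by simp
  moreover have "r w = ?t w"
    using boxed_section_unique[OF cov bV'(1) rV' t, of z w] z w r(2) sz(2) by simp
  ultimately show ?thesis by simp
qed

lemma sheet_through_point:
  assumes \<V>: "good_cover X \<V>" and q: "sheeted_covering n E X q" and e: "e \<in> topspace E"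
  obtains V i where "V \<in> \<V>" "i < n" "q e \<in> V" "sheet n E X q V i (q e) = e"
proof -
  have cov: "covering_map E X q" using q by (simp add: sheeted_covering_def)
  have "q e \<in> \<Union>\<V>"
    using covering_map_image[OF cov] e good_coverD(2)[OF \<V>] by blast
  then obtain V where V: "V \<in> \<V>" "q e \<in> V" by blast
  then have b: "boxed X V" "V \<noteq> {}"
    using \<V> by (simp_all add: good_cover_def)
  have "e \<in> fibre E q (q e)" using e by (simp add: fibre_def)
  then have "e \<in> (\<lambda>i. sheet n E X q V i (q e)) ` {..<n}"
    using sheet_properties(2)[OF q b V(2)] by (simp add: bij_betw_def)
  then obtain i where i: "e = sheet n E X q V i (q e)" "i \<in> {..<n}"
    by (rule imageE)
  show thesis
    using i by (intro that[OF V(1) _ V(2), of i]) simp_all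
qed

text \<open>The map sends each sheet to the sheet with the same number. It is well defined over the overlaps because the
gluing data agree, and continuous because the image of a sheet is open.\<close>

lemma coverings_with_equal_gluing_map:
  assumes \<V>: "good_cover X \<V>" and q: "sheeted_covering n E X q" and q': "sheeted_covering n E' X q'"
    and eq: "gluing n X \<V> E q = gluing n X \<V> E' q'"
  obtains f where "continuous_map E E' f"
    "\<And>V i x. V \<in> \<V> \<Longrightarrow> i < n \<Longrightarrow> x \<in> V \<Longrightarrow> f (sheet n E X q V i x) = sheet n E' X q' V i x"
proof -
  let ?s = "sheet n E X q" and ?s' = "sheet n E' X q'"
  have cov: "covering_map E X q" and cov': "covering_map E' X q'"
    using q q' by (simp_all add: sheeted_covering_def)
  have b: "boxed X V" "V \<noteq> {}" if "V \<in> \<V>" for V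
    using \<V> that by (simp_all add: good_cover_def)
  have s: "lift_of E q (subtopology X V) (\<lambda>x. x) (?s V i)" if "V \<in> \<V>" "i < n" for V i
    using sheet_properties(1)[OF q b[OF that(1)] that(2)] .
  have s': "lift_of E' q' (subtopology X V) (\<lambda>x. x) (?s' V i)" if "V \<in> \<V>" "i < n" for V i
    using sheet_properties(1)[OF q' b[OF that(1)] that(2)] .
  have qs: "?s V i x \<in> topspace E" "q (?s V i x) = x" if "V \<in> \<V>" "i < n" "x \<in> V" for V i x
    using section_in_fibre[OF s[OF that(1,2)] that(3) boxed_imp_subset[OF b(1)[OF that(1)]]] by simp_all
  define O' where "O' = (\<lambda>(V, i). {e \<in> topspace E. q e \<in> V \<and> ?s V i (q e) = e})"
  have compat: "?s' V i x = ?s' V' j x"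
    if V: "V \<in> \<V>" "i < n" "V' \<in> \<V>" "j < n" "x \<in> V" "x \<in> V'" "?s V i x = ?s V' j x" for V i V' j x
  proof -
    have "((V, i), (V', j)) \<in> gluing n X \<V> E q"
      using V unfolding gluing_def by blast
    then have "((V, i), (V', j)) \<in> gluing n X \<V> E' q'"
      using eq by simp
    then obtain z where "z \<in> V \<inter> V'" "?s' V i z = ?s' V' j z"
      unfolding gluing_def by blast
    then show ?thesis
      using sheets_agree_on_overlap[OF \<V> q' V(1-4), of z x] V(5,6) by blast
  qed
  have open_O: "openin E (O' (V, i))" if "V \<in> \<V>" "i < n" for V i
  proof -
    let ?Y = "subtopology E {e \<in> topspace E. q e \<in> V}"
    have oV: "openin E {e \<in> topspace E. q e \<in> V}"
      using covering_map_continuous[OF cov] boxed_imp_openin[OF b(1)[OF that(1)]]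
      by (rule openin_continuous_map_preimage)
    have "continuous_map ?Y (subtopology X V) q"
      by (rule continuous_map_into_subtopology[OF continuous_map_from_subtopology[OF covering_map_continuous[OF cov]]]) auto
    moreover have "continuous_map (subtopology X V) E (?s V i)"
      using s[OF that] by (simp add: lift_of_def)
    ultimately have "continuous_map ?Y E (?s V i \<circ> q)"
      by (rule continuous_map_compose)
    then have "lift_of E q ?Y q (?s V i \<circ> q)"
      using qs(2)[OF that] by (simp add: lift_of_def)
    moreover have "lift_of E q ?Y q (\<lambda>e. e)"
      by (simp add: lift_of_def continuous_map_from_subtopology)
    ultimately have "openin ?Y {e \<in> topspace ?Y. (?s V i \<circ> q) e = e}"
      by (rule openin_lift_agreement[OF cov])
    moreover have "{e \<in> topspace ?Y. (?s V i \<circ> q) e = e} = O' (V, i)"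
      by (auto simp: O'_def)
    ultimately have "openin ?Y (O' (V, i))"
      by simp
    then show ?thesis
      using oV by (rule openin_trans_full)
  qed
  let ?I = "\<V> \<times> {..<n}"
  let ?F = "\<lambda>(V, i). ?s' V i \<circ> q"
  have cover: "topspace E \<subseteq> (\<Union>k\<in>?I. O' k)"
  proof
    fix e assume e: "e \<in> topspace E"
    obtain V i where "V \<in> \<V>" "i < n" "q e \<in> V" "?s V i (q e) = e"
      by (rule sheet_through_point[OF \<V> q e])
    then show "e \<in> (\<Union>k\<in>?I. O' k)"
      using e by (intro UN_I[of "(V, i)"]) (simp_all add: O'_def)
  qed
  obtain f where f: "continuous_map E E' f"
    "\<And>e k. k \<in> ?I \<Longrightarrow> e \<in> topspace E \<inter> O' k \<Longrightarrow> f e = ?F k e"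
  proof (rule pasting_lemma_exists[OF cover, of E' ?F])
    fix k assume k: "k \<in> ?I"
    then show "openin E (O' k)" using open_O by auto
    obtain V i where Vi: "k = (V, i)" "V \<in> \<V>" "i < n" using k by auto
    have "continuous_map (subtopology E (O' k)) (subtopology X V) q"
      by (rule continuous_map_into_subtopology[OF continuous_map_from_subtopology[OF covering_map_continuous[OF cov]]])
        (auto simp: O'_def Vi(1))
    moreover have "continuous_map (subtopology X V) E' (?s' V i)"
      using s'[OF Vi(2,3)] by (simp add: lift_of_def)
    ultimately have "continuous_map (subtopology E (O' k)) E' (?s' V i \<circ> q)"
      by (rule continuous_map_compose)
    then show "continuous_map (subtopology E (O' k)) E' (?F k)"
      by (simp add: Vi(1))
  next
    fix k l e assume kl: "k \<in> ?I" "l \<in> ?I" "e \<in> topspace E \<inter> O' k \<inter> O' l"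
    obtain V i V' j where "k = (V, i)" "l = (V', j)" by (cases k; cases l)
    then show "?F k e = ?F l e"
      using kl compat[of V i V' j "q e"] by (simp add: O'_def)
  next
    fix g assume "continuous_map E E' g"
      "\<And>e k. k \<in> ?I \<Longrightarrow> e \<in> topspace E \<inter> O' k \<Longrightarrow> g e = ?F k e"
    then show thesis by (rule that)
  qed
  have "f (?s V i x) = ?s' V i x" if V: "V \<in> \<V>" "i < n" "x \<in> V" for V i x
    using f(2)[of "(V, i)" "?s V i x"] V qs[OF V] by (simp add: O'_def)
  with f(1) show thesis by (rule that)
qed

lemma coverings_with_equal_gluing_isomorphic:
  assumes \<V>: "good_cover X \<V>" and q: "sheeted_covering n E X q" and q': "sheeted_covering n E' X q'"
    and eq: "gluing n X \<V> E q = gluing n X \<V> E' q'"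
  obtains f g where "homeomorphic_maps E E' f g"
    "\<And>e. e \<in> topspace E \<Longrightarrow> q' (f e) = q e"
proof -
  let ?s = "sheet n E X q" and ?s' = "sheet n E' X q'"
  obtain f where f: "continuous_map E E' f"
    "\<And>V i x. V \<in> \<V> \<Longrightarrow> i < n \<Longrightarrow> x \<in> V \<Longrightarrow> f (?s V i x) = ?s' V i x"
    by (rule coverings_with_equal_gluing_map[OF \<V> q q' eq]) (rule that)
  obtain g where g: "continuous_map E' E g"
    "\<And>V i x. V \<in> \<V> \<Longrightarrow> i < n \<Longrightarrow> x \<in> V \<Longrightarrow> g (?s' V i x) = ?s V i x"
    by (rule coverings_with_equal_gluing_map[OF \<V> q' q eq[symmetric]]) (rule that)
  have gf: "g (f e) = e" "q' (f e) = q e" if e: "e \<in> topspace E" for e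
  proof -
    obtain V i where V: "V \<in> \<V>" "i < n" "q e \<in> V" "?s V i (q e) = e"
      by (rule sheet_through_point[OF \<V> q e])
    have b: "boxed X V" "V \<noteq> {}"
      using \<V> V(1) by (simp_all add: good_cover_def)
    show "g (f e) = e" using f(2)[OF V(1-3)] g(2)[OF V(1-3)] V(4) by simp
    show "q' (f e) = q e"
      using section_in_fibre(2)[OF sheet_properties(1)[OF q' b V(2)] V(3) boxed_imp_subset[OF b(1)]]
        f(2)[OF V(1-3)] V(4) by simp
  qed
  have fg: "f (g e) = e" if e: "e \<in> topspace E'" for e
  proof -
    obtain V i where V: "V \<in> \<V>" "i < n" "q' e \<in> V" "?s' V i (q' e) = e"
      by (rule sheet_through_point[OF \<V> q' e])
    show "f (g e) = e" using f(2)[OF V(1-3)] g(2)[OF V(1-3)] V(4) by simp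
  qed
  have "homeomorphic_maps E E' f g"
    using f(1) g(1) gf(1) fg by (simp add: homeomorphic_maps_def)
  then show thesis using gf(2) by (rule that)
qed

section \<open>Powers of homeomorphisms lift, and deck transformations are few\<close>

lemma homeomorphic_map_funpow:
  assumes "homeomorphic_map X X g"
  shows "homeomorphic_map X X (g ^^ k)"
proof (induction k)
  case 0
  show ?case by (simp add: homeomorphic_map_id[unfolded id_def] id_def)
next
  case (Suc k)
  show ?case
    using homeomorphic_map_compose[OF Suc.IH assms] by (simp add: comp_def)
qed

lemma covers_funpow:
  assumes f: "f \<in> topspace E \<rightarrow> topspace E" and pf: "\<And>e. e \<in> topspace E \<Longrightarrow> p (f e) = h (p e)"
    and e: "e \<in> topspace E"
  shows "(f ^^ k) e \<in> topspace E \<and> p ((f ^^ k) e) = (h ^^ k) (p e)"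
proof (induction k)
  case 0
  then show ?case using e by simp
next
  case (Suc k)
  then show ?case using f pf by auto
qed

text \<open>An isomorphism between the coverings \<open>(g ^^ i) \<circ> p\<close> and \<open>(g ^^ j) \<circ> p\<close> covers \<open>g ^^ (j - i)\<close>. The exponent
\<open>fact M\<close>, with \<open>M\<close> the number of possible gluing data, is a multiple of every such difference.\<close>

lemma power_of_homeomorphism_lifts:
  fixes E :: "'b topology" and X :: "'a topology"
  assumes X: "closed_manifold X" "connected_space X" and p: "finite_covering_map E X p"
  obtains N where "N > 0"
    "\<And>g. homeomorphic_map X X g \<Longrightarrow>
      \<exists>f. homeomorphic_map E E f \<and> (\<forall>e\<in>topspace E. p (f e) = (g ^^ N) (p e))"
proof -
  obtain n where n: "sheeted_covering n E X p"
    by (rule sheeted_covering_exists[OF X p])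
  then have cov: "covering_map E X p" by (simp add: sheeted_covering_def)
  obtain \<V> where \<V>: "good_cover X \<V>"
    by (rule closed_manifold_good_cover[OF X(1)])
  define C where "C = Pow ((\<V> \<times> {..<n}) \<times> (\<V> \<times> {..<n}))"
  have finC: "finite C"
    using good_coverD(1)[OF \<V>] by (simp add: C_def)
  define M where "M = card C"
  have "\<exists>f. homeomorphic_map E E f \<and> (\<forall>e\<in>topspace E. p (f e) = (g ^^ fact M) (p e))"
    if g: "homeomorphic_map X X g" for g
  proof -
    have gk: "homeomorphic_map X X (g ^^ k)" for k
      using g by (rule homeomorphic_map_funpow)
    have cg: "sheeted_covering n E X ((g ^^ k) \<circ> p)" for k
      using n gk by (rule sheeted_covering_compose_homeomorphic)
    let ?c = "\<lambda>k. gluing n X \<V> E ((g ^^ k) \<circ> p)"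
    have "?c ` {..M} \<subseteq> C"
      using gluing_in_Pow unfolding C_def by blast
    then have "card (?c ` {..M}) < card {..M}"
      using card_mono[OF finC, of "?c ` {..M}"] by (simp add: M_def)
    then have "\<not> inj_on ?c {..M}"
      by (rule pigeonhole)
    then obtain i j where ij: "i \<le> M" "j \<le> M" "i < j" "?c i = ?c j"
      unfolding inj_on_def by (metis atMost_iff linorder_neqE_nat)
    obtain f f' where f: "homeomorphic_maps E E f f'"
      "\<And>e. e \<in> topspace E \<Longrightarrow> ((g ^^ i) \<circ> p) (f e) = ((g ^^ j) \<circ> p) e"
      by (rule coverings_with_equal_gluing_isomorphic[OF \<V> cg cg ij(4)[symmetric]]) (rule that)
    have fE: "f \<in> topspace E \<rightarrow> topspace E"
      using f(1) continuous_map_funspace unfolding homeomorphic_maps_def by blast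
    have pE: "\<And>e. e \<in> topspace E \<Longrightarrow> p e \<in> topspace X"
      using covering_map_image[OF cov] by blast
    define d where "d = j - i"
    have pf: "p (f e) = (g ^^ d) (p e)" if e: "e \<in> topspace E" for e
    proof -
      have "(g ^^ i) (p (f e)) = (g ^^ (i + d)) (p e)"
        using f(2)[OF e] ij(3) by (simp add: d_def)
      also have "\<dots> = (g ^^ i) ((g ^^ d) (p e))"
        by (simp add: funpow_add)
      finally have "(g ^^ i) (p (f e)) = (g ^^ i) ((g ^^ d) (p e))" .
      moreover have "p (f e) \<in> topspace X"
        using pE fE e by blast
      moreover have "(g ^^ d) (p e) \<in> topspace X"
        using homeomorphic_imp_surjective_map[OF gk[of d]] pE[OF e] by blast
      ultimately show ?thesis
        using homeomorphic_imp_injective_map[OF gk[of i]] by (simp add: inj_on_def)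
    qed
    have "d dvd fact M"
      using ij by (intro dvd_fact) (simp_all add: d_def)
    then obtain k where k: "fact M = d * k" by (auto elim: dvdE)
    have "homeomorphic_map E E (f ^^ k)"
      using f(1) by (intro homeomorphic_map_funpow) (auto simp: homeomorphic_map_maps)
    moreover have "p ((f ^^ k) e) = (g ^^ fact M) (p e)" if e: "e \<in> topspace E" for e
      using covers_funpow[of f E p "g ^^ d" e k, OF fE pf e] by (simp add: k funpow_mult mult.commute)
    ultimately show ?thesis by blast
  qed
  then show thesis
    by (intro that[of "fact M"]) simp_all
qed

text \<open>Over a connected base a deck transformation is determined by its values on one fibre, and the fibre is finite.\<close>

lemma deck_transformations_finite:
  assumes X: "closed_manifold X" "connected_space X" and p: "finite_covering_map E X p"
  shows "finite {f \<in> Bij (topspace E). continuous_map E E f \<and> (\<forall>e\<in>topspace E. p (f e) = p e)}"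
    (is "finite ?D")
proof (cases "topspace X = {}")
  case True
  have "topspace E = {}"
    using p True by (auto simp: finite_covering_map_def dest: covering_map_image)
  then have "?D \<subseteq> {\<lambda>x. undefined}"
    by (auto simp: Bij_def)
  then show ?thesis by (rule finite_subset) simp
next
  case False
  then obtain x0 where x0: "x0 \<in> topspace X" by blast
  obtain m where m: "topological_manifold m X"
    using X(1) by (auto simp: closed_manifold_def)
  have cov: "covering_map E X p" and fin: "finite (fibre E p x0)"
    using p x0 by (auto simp: finite_covering_map_def fibre_def)
  let ?r = "\<lambda>f. restrict f (fibre E p x0)"
  have "inj_on ?r ?D"
  proof (rule inj_onI)
    fix f f' assume f: "f \<in> ?D" and f': "f' \<in> ?D" and eq: "?r f = ?r f'"
    define P where "P x \<longleftrightarrow> (\<forall>e\<in>fibre E p x. f e = f' e)" for x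
    have propagate: "P y"
      if V: "boxed X V" and x: "x \<in> V" "P x" and y: "y \<in> V" for V x y
      unfolding P_def
    proof
      fix e assume "e \<in> fibre E p y"
      then have e: "e \<in> topspace E" "p e = y" by (simp_all add: fibre_def)
      have peV: "p e \<in> V" using e(2) y by simp
      obtain s where s: "lift_of E p (subtopology X V) (\<lambda>x. x) s" "s (p e) = e"
        by (rule boxed_section[OF cov V e(1) peV])
      have VX: "V \<subseteq> topspace X" using V by (rule boxed_imp_subset)
      have lift: "lift_of E p (subtopology X V) (\<lambda>x. x) (h \<circ> s)" if h: "h \<in> ?D" for h
        unfolding lift_of_def
      proof (intro conjI ballI)
        show "continuous_map (subtopology X V) E (h \<circ> s)"
          using s(1) h by (intro continuous_map_compose[of _ E]) (simp_all add: lift_of_def)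
        fix z assume "z \<in> topspace (subtopology X V)"
        then have "z \<in> V" by simp
        then have "s z \<in> topspace E" "p (s z) = z"
          using section_in_fibre[OF s(1) _ VX] by simp_all
        then show "p ((h \<circ> s) z) = z" using h by simp
      qed
      have "s x \<in> fibre E p x"
        by (rule section_in_fibre(3)[OF s(1) x(1) VX])
      then have "(f \<circ> s) x = (f' \<circ> s) x"
        using x(2) by (simp add: P_def)
      then have "(f \<circ> s) y = (f' \<circ> s) y"
        using boxed_section_unique[OF cov V lift[OF f] lift[OF f'] x(1) _ y] by blast
      then show "f e = f' e" using s(2) e(2) by simp
    qed
    have P0: "P x0"
      unfolding P_def using eq by (metis restrict_apply)
    have "P x" if x: "x \<in> topspace X" for x
    proof (rule connected_space_locally_constant[where P = P and x = x0, OF X(2) _ x0 x P0])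
      fix x assume x: "x \<in> topspace X"
      obtain V where V: "boxed X V" "x \<in> V"
        by (rule manifold_boxed_base[OF m openin_topspace x])
      have "\<forall>y\<in>V. P y \<longleftrightarrow> P x"
        using propagate[OF V(1)] V(2) by blast
      then show "\<exists>V. openin X V \<and> x \<in> V \<and> (\<forall>y\<in>V. P y \<longleftrightarrow> P x)"
        using V(2) boxed_imp_openin[OF V(1)] by blast
    qed
    then have "f e = f' e" if e: "e \<in> topspace E" for e
    proof -
      have "p e \<in> topspace X" using covering_map_image[OF cov] e by blast
      then have "P (p e)" by (rule \<open>\<And>x. x \<in> topspace X \<Longrightarrow> P x\<close>)
      then show ?thesis using e by (simp add: P_def fibre_def)
    qed
    then show "f = f'"
      using f f' by (intro extensionalityI[of f "topspace E" f']) (auto simp: Bij_def)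
  qed
  moreover have "?r ` ?D \<subseteq> fibre E p x0 \<rightarrow>\<^sub>E fibre E p x0"
  proof
    fix h assume "h \<in> ?r ` ?D"
    then obtain f where f: "f \<in> ?D" "h = ?r f" by blast
    have "f e \<in> fibre E p x0" if "e \<in> fibre E p x0" for e
      using f(1) that Bij_imp_funcset[of f "topspace E"] by (auto simp: fibre_def)
    then show "h \<in> fibre E p x0 \<rightarrow>\<^sub>E fibre E p x0"
      using f(2) by auto
  qed
  then have "finite (?r ` ?D)"
    using finite_PiE[OF fin, of "\<lambda>_. fibre E p x0"] fin by (auto intro: finite_subset)
  ultimately show ?thesis
    by (rule finite_imageD[rotated])
qed

section \<open>Bases of integer lattices, and words in commuting group elements\<close>

text \<open>The basis is triangular, as in the Hermite normal form: among the vectors of \<open>L\<close> whose first \<open>j\<close>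
coordinates vanish, \<open>f j\<close> has the least positive \<open>j\<close>-th coordinate; one exists since \<open>L\<close> contains \<open>e\<close> times
the unit vectors. Division with remainder by this leading coordinate shows that the vectors span,
and triangularity that they are independent. Elements of \<open>\<int>\<^sup>m\<close> are functions that vanish from \<open>m\<close> on.\<close>

lemma int_lattice_basis:
  fixes L :: "(nat \<Rightarrow> int) set" and e :: int
  assumes diff: "\<And>u v. u \<in> L \<Longrightarrow> v \<in> L \<Longrightarrow> (\<lambda>i. u i - v i) \<in> L"
    and supp: "\<And>u i. u \<in> L \<Longrightarrow> i \<ge> m \<Longrightarrow> u i = 0"
    and e: "e > 0" and unit: "\<And>j. j < m \<Longrightarrow> (\<lambda>i. if i = j then e else 0) \<in> L"
  shows "\<exists>f. (\<forall>j<m. f j \<in> L) \<and> (\<forall>v\<in>L. \<exists>y. \<forall>i. v i = (\<Sum>j<m. y j * f j i)) \<and>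
    (\<forall>y. (\<forall>i. (\<Sum>j<m. y j * f j i) = 0) \<longrightarrow> (\<forall>j<m. y j = 0))"
proof -
  have zero: "(\<lambda>i. 0) \<in> L" if "u \<in> L" for u
    using diff[OF that that] by simp
  have neg: "(\<lambda>i. - u i) \<in> L" if "u \<in> L" for u
    using diff[OF zero[OF that] that] by simp
  have add: "(\<lambda>i. u i + v i) \<in> L" if "u \<in> L" "v \<in> L" for u v
    using diff[OF that(1) neg[OF that(2)]] by simp
  have nscale: "(\<lambda>i. int k * u i) \<in> L" if "u \<in> L" for k u
  proof (induction k)
    case 0
    show ?case using zero[OF that] by simp
  next
    case (Suc k)
    show ?case using add[OF that Suc.IH] by (simp add: algebra_simps)
  qed
  have scale: "(\<lambda>i. c * u i) \<in> L" if "u \<in> L" for c u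
  proof (cases "c \<ge> 0")
    case True
    then show ?thesis using nscale[OF that, of "nat c"] by simp
  next
    case False
    then show ?thesis using nscale[OF neg[OF that], of "nat (- c)"] by simp
  qed
  define lead where "lead j d \<longleftrightarrow> d > 0 \<and> (\<exists>u\<in>L. (\<forall>i<j. u i = 0) \<and> u j = int d)" for j d
  have "lead j (nat e)" if "j < m" for j
    unfolding lead_def using e unit[OF that]
    by (intro conjI bexI[of _ "\<lambda>i. if i = j then e else 0"]) auto
  then have lead: "lead j (LEAST d. lead j d)" if "j < m" for j
    using that by (blast intro: LeastI)
  define d where "d j = (LEAST d. lead j d)" for j
  have least: "d j \<le> k" if "lead j k" for j k
    unfolding d_def using that by (rule Least_le)
  have "\<forall>j\<in>{..<m}. \<exists>u. u \<in> L \<and> (\<forall>i<j. u i = 0) \<and> u j = int (d j)"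
    using lead unfolding lead_def d_def by blast
  from bchoice[OF this] obtain f where f: "\<And>j. j < m \<Longrightarrow> f j \<in> L"
    "\<And>j i. j < m \<Longrightarrow> i < j \<Longrightarrow> f j i = 0" "\<And>j. j < m \<Longrightarrow> f j j = int (d j)"
    by auto
  have dpos: "d j > 0" if "j < m" for j
    using lead[OF that] unfolding lead_def d_def by blast
  have span: "\<exists>y. \<forall>i. v i = (\<Sum>j<m. y j * f j i)"
    if "k \<le> m" "v \<in> L" "\<And>i. i < m - k \<Longrightarrow> v i = 0" for k v
    using that
  proof (induction k arbitrary: v)
    case 0
    then have "v i = 0" for i
      using supp[OF 0(2), of i] by (cases "i < m") simp_all
    then show ?case by (intro exI[of _ "\<lambda>_. 0"]) simp
  next
    case (Suc k)
    define j where "j = m - Suc k"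
    have j: "j < m" "m - k = Suc j" using Suc.prems(1) by (auto simp: j_def)
    define c where "c = v j div int (d j)"
    define w where "w = (\<lambda>i. v i - c * f j i)"
    have wL: "w \<in> L"
      unfolding w_def using diff[OF Suc.prems(2) scale[OF f(1)[OF j(1)]]] .
    have w0: "w i = 0" if "i < j" for i
      using Suc.prems(3)[of i] f(2)[OF j(1) that] that by (simp add: w_def j_def)
    have wj: "w j = v j mod int (d j)"
      using f(3)[OF j(1)] by (simp add: w_def c_def minus_div_mult_eq_mod)
    have "w j = 0"
    proof (rule ccontr)
      assume "w j \<noteq> 0"
      moreover have "w j \<ge> 0" "w j < int (d j)"
        using dpos[OF j(1)] by (simp_all add: wj)
      ultimately have "lead j (nat (w j))"
        unfolding lead_def using wL w0 by (intro conjI bexI[of _ w]) auto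
      then have "d j \<le> nat (w j)" by (rule least)
      then show False using \<open>w j < int (d j)\<close> \<open>w j \<ge> 0\<close> by linarith
    qed
    then have "w i = 0" if "i < m - k" for i
      using w0[of i] that j(2) by (cases "i = j") simp_all
    then obtain y where y: "\<And>i. w i = (\<Sum>l<m. y l * f l i)"
      using Suc.IH[OF _ wL] Suc.prems(1) by auto
    have "v i = (\<Sum>l<m. (y l + (if l = j then c else 0)) * f l i)" for i
    proof -
      have "(\<Sum>l<m. (y l + (if l = j then c else 0)) * f l i) =
          (\<Sum>l<m. y l * f l i) + (\<Sum>l<m. if l = j then c * f l i else 0)"
        unfolding sum.distrib[symmetric] by (intro sum.cong) (auto simp: algebra_simps)
      also have "\<dots> = w i + c * f j i"
        using j(1) by (simp add: y)
      finally show ?thesis by (simp add: w_def)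
    qed
    then show ?case by (intro exI[of _ "\<lambda>l. y l + (if l = j then c else 0)"] allI)
  qed
  have indep: "y j = 0" if y: "\<And>i. (\<Sum>j<m. y j * f j i) = 0" and j: "j < m" for y j
    using j
  proof (induction j rule: less_induct)
    case (less j)
    have "(\<Sum>l<m. y l * f l j) = (\<Sum>l<m. if l = j then y j * int (d j) else 0)"
    proof (intro sum.cong refl)
      fix l assume l: "l \<in> {..<m}"
      consider "l < j" | "l = j" | "j < l" by linarith
      then show "y l * f l j = (if l = j then y j * int (d j) else 0)"
      proof cases
        case 1 then show ?thesis using less.IH[of l] l by simp
      next
        case 2 then show ?thesis using f(3)[of j] l by simp
      next
        case 3 then show ?thesis using f(2)[of l j] l by simp
      qed
    qed
    also have "\<dots> = y j * int (d j)"
      using less.prems by simp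
    finally show ?case using y[of j] dpos[OF less.prems] by simp
  qed
  have "\<exists>y. \<forall>i. v i = (\<Sum>j<m. y j * f j i)" if "v \<in> L" for v
    using span[of m v] that by simp
  then show ?thesis
    using f(1) indep by (intro exI[of _ f]) blast
qed

lemma pigeonhole_sequence:
  assumes "finite S" "\<And>k. k \<le> card S \<Longrightarrow> w k \<in> S"
  obtains i j where "i < j" "j \<le> card S" "w i = w j"
proof -
  have "w ` {..card S} \<subseteq> S" using assms(2) by auto
  then have "card (w ` {..card S}) < card {..card S}"
    using card_mono[OF assms(1)] by (simp add: less_Suc_eq_le)
  then have "\<not> inj_on w {..card S}" by (rule pigeonhole)
  then obtain i j where "i \<le> card S" "j \<le> card S" "i \<noteq> j" "w i = w j"
    unfolding inj_on_def by auto
  then show thesis using that[of i j] that[of j i] by (cases i j rule: linorder_cases) auto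
qed

lemma (in group) left_cancel_imp:
  "x \<otimes> y = x \<otimes> z \<Longrightarrow> x \<in> carrier G \<Longrightarrow> y \<in> carrier G \<Longrightarrow> z \<in> carrier G \<Longrightarrow> y = z"
  by simp

lemma (in group) right_cancel_imp:
  "y \<otimes> x = z \<otimes> x \<Longrightarrow> x \<in> carrier G \<Longrightarrow> y \<in> carrier G \<Longrightarrow> z \<in> carrier G \<Longrightarrow> y = z"
  by simp

lemma (in group) commutes_nat_pow:
  assumes "x \<in> carrier G" "y \<in> carrier G" "x \<otimes> y = y \<otimes> x"
  shows "x [^] (k::nat) \<otimes> y = y \<otimes> x [^] k"
proof (induction k)
  case 0
  then show ?case using assms by simp
next
  case (Suc k)
  have "x [^] Suc k \<otimes> y = x [^] k \<otimes> (x \<otimes> y)"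
    using assms(1,2) by (simp add: m_assoc)
  also have "\<dots> = (x [^] k \<otimes> y) \<otimes> x"
    using assms(1,2) by (simp add: assms(3) m_assoc)
  also have "\<dots> = y \<otimes> x [^] Suc k"
    using assms(1,2) by (simp add: Suc.IH m_assoc)
  finally show ?case .
qed

lemma (in group) commutes_int_pow:
  assumes x: "x \<in> carrier G" and y: "y \<in> carrier G" and xy: "x \<otimes> y = y \<otimes> x"
  shows "x [^] (k::int) \<otimes> y = y \<otimes> x [^] k"
proof (cases "k < 0")
  case False
  then have "x [^] k = x [^] nat k" by (subst int_pow_def2, simp)
  then show ?thesis using commutes_nat_pow[OF assms, of "nat k"] by simp
next
  case True
  let ?z = "x [^] (nat (- k))"
  have z: "?z \<in> carrier G" "?z \<otimes> y = y \<otimes> ?z"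
    by (rule nat_pow_closed[OF x], rule commutes_nat_pow[OF assms])
  have "inv ?z \<otimes> y = inv ?z \<otimes> (y \<otimes> ?z) \<otimes> inv ?z"
    using z(1) y by (simp add: m_assoc)
  also have "\<dots> = inv ?z \<otimes> (?z \<otimes> y) \<otimes> inv ?z"
    by (simp only: z(2))
  also have "\<dots> = y \<otimes> inv ?z"
    using z(1) y by (simp add: m_assoc[symmetric])
  finally have "inv ?z \<otimes> y = y \<otimes> inv ?z" .
  moreover have "x [^] k = inv ?z" using True by (subst int_pow_def2, simp)
  ultimately show ?thesis by simp
qed

text \<open>A product over the indices in a fixed order: the elements \<open>b j\<close> will commute with each other, but the group
that contains them is not abelian, so that \<open>finprod\<close> does not apply.\<close>

primrec power_word :: "('g, 'm) monoid_scheme \<Rightarrow> (nat \<Rightarrow> 'g) \<Rightarrow> (nat \<Rightarrow> int) \<Rightarrow> nat \<Rightarrow> 'g" where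
  "power_word G b k 0 = \<one>\<^bsub>G\<^esub>"
| "power_word G b k (Suc n) = power_word G b k n \<otimes>\<^bsub>G\<^esub> b n [^]\<^bsub>G\<^esub> k n"

lemma (in group) power_word_closed:
  "(\<And>j. j < n \<Longrightarrow> b j \<in> carrier G) \<Longrightarrow> power_word G b k n \<in> carrier G"
  by (induction n) simp_all

lemma (in group) power_word_commutes:
  assumes "\<And>j. j < n \<Longrightarrow> b j \<in> carrier G" "y \<in> carrier G" "\<And>j. j < n \<Longrightarrow> b j \<otimes> y = y \<otimes> b j"
  shows "power_word G b k n \<otimes> y = y \<otimes> power_word G b k n"
  using assms
proof (induction n)
  case 0
  then show ?case by simp
next
  case (Suc n)
  let ?p = "power_word G b k n" and ?q = "b n [^] k n"
  have p: "?p \<in> carrier G" "?p \<otimes> y = y \<otimes> ?p"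
    using Suc by (simp_all add: power_word_closed)
  have q: "?q \<in> carrier G" "?q \<otimes> y = y \<otimes> ?q"
    using Suc.prems by (simp_all add: commutes_int_pow)
  have "?p \<otimes> ?q \<otimes> y = ?p \<otimes> (?q \<otimes> y)"
    using p q Suc.prems(2) by (simp add: m_assoc)
  also have "\<dots> = ?p \<otimes> y \<otimes> ?q"
    using p(1) q Suc.prems(2) by (simp add: m_assoc)
  also have "\<dots> = y \<otimes> (?p \<otimes> ?q)"
    using p q(1) Suc.prems(2) by (simp add: m_assoc)
  finally show ?case by simp
qed

lemma (in group) power_word_add:
  assumes b: "\<And>j. j < n \<Longrightarrow> b j \<in> carrier G"
    and comm: "\<And>i j. i < n \<Longrightarrow> j < n \<Longrightarrow> b i \<otimes> b j = b j \<otimes> b i"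
  shows "power_word G b (\<lambda>i. k i + l i) n = power_word G b k n \<otimes> power_word G b l n"
  using assms
proof (induction n)
  case 0
  then show ?case by simp
next
  case (Suc n)
  let ?p = "power_word G b k n" and ?q = "power_word G b l n"
  let ?x = "b n [^] k n" and ?y = "b n [^] l n"
  have bn: "b n \<in> carrier G" and c: "?p \<in> carrier G" "?q \<in> carrier G" "?x \<in> carrier G" "?y \<in> carrier G"
    using Suc.prems(1) by (simp_all add: power_word_closed)
  have "b n \<otimes> ?q = ?q \<otimes> b n"
    using power_word_commutes[of n b "b n" l] Suc.prems by simp
  then have xq: "?x \<otimes> ?q = ?q \<otimes> ?x"
    using bn c by (intro commutes_int_pow)
  have "power_word G b (\<lambda>i. k i + l i) (Suc n) = (?p \<otimes> ?q) \<otimes> (?x \<otimes> ?y)"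
    using Suc bn by (simp add: int_pow_mult)
  also have "\<dots> = ?p \<otimes> (?q \<otimes> ?x) \<otimes> ?y"
    using c by (simp add: m_assoc)
  also have "\<dots> = ?p \<otimes> (?x \<otimes> ?q) \<otimes> ?y"
    by (simp add: xq)
  also have "\<dots> = (?p \<otimes> ?x) \<otimes> (?q \<otimes> ?y)"
    using c by (simp add: m_assoc)
  finally show ?case by simp
qed

lemma (in group) power_word_zero: "power_word G b (\<lambda>_. 0) n = \<one>"
  by (induction n) simp_all

section \<open>Finite extensions of homocyclic groups\<close>

text \<open>Here \<open>\<pi>\<close> is a homomorphism to \<open>(\<int>/r)\<^sup>m\<close>, given by representatives of its coordinates, with finite kernel \<open>K\<close>
and with image containing \<open>D\<close> times each unit vector. The bound on \<open>r\<close> involves only \<open>D\<close> and the order of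
\<open>K\<close>, which is the point: both stay fixed while \<open>r\<close> tends to infinity.\<close>

lemma (in group) Zmod_power_in_finite_extension:
  fixes \<pi> :: "'a \<Rightarrow> nat \<Rightarrow> int" and r D :: int
  assumes r: "r > 0" and D: "D > 0"
    and hom: "\<And>a b i. a \<in> carrier G \<Longrightarrow> b \<in> carrier G \<Longrightarrow> i < m \<Longrightarrow> [\<pi> (a \<otimes> b) i = \<pi> a i + \<pi> b i] (mod r)"
    and K: "K = {a \<in> carrier G. \<forall>i<m. [\<pi> a i = 0] (mod r)}" and finK: "finite K"
    and lifts: "\<And>j. j < m \<Longrightarrow> \<exists>a\<in>carrier G. \<forall>i<m. [\<pi> a i = (if i = j then D else 0)] (mod r)"
  obtains s \<psi> where "s > 0" "r \<le> s * (D * fact (card K))"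
    "\<psi> \<in> hom (Zmod_power s m) G" "inj_on \<psi> (carrier (Zmod_power s m))"
proof -
  let ?K = "{a \<in> carrier G. \<forall>i<m. [\<pi> a i = 0] (mod r)}"
  have fin: "finite ?K" using finK K by simp
  let ?N = "fact (card ?K) :: nat"
  have pi_one: "[\<pi> \<one> i = 0] (mod r)" if "i < m" for i
  proof -
    have "[\<pi> \<one> i + 0 = \<pi> \<one> i + \<pi> \<one> i] (mod r)"
      using hom[OF one_closed one_closed that] by simp
    then show ?thesis by (simp only: cong_add_lcancel cong_sym_eq)
  qed
  have pi_inv: "[\<pi> (inv a) i = - \<pi> a i] (mod r)" if "a \<in> carrier G" "i < m" for a i
  proof -
    have "[\<pi> \<one> i = \<pi> a i + \<pi> (inv a) i] (mod r)"
      using hom[OF that(1) inv_closed[OF that(1)] that(2)] that(1) by simp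
    then have "[\<pi> a i + \<pi> (inv a) i = 0] (mod r)"
      using pi_one[OF that(2)] by (meson cong_sym cong_trans)
    then have "[\<pi> a i + \<pi> (inv a) i - \<pi> a i = 0 - \<pi> a i] (mod r)"
      by (intro cong_diff cong_refl)
    then show ?thesis by simp
  qed
  have pi_nat_pow: "[\<pi> (a [^] k) i = int k * \<pi> a i] (mod r)" if "a \<in> carrier G" "i < m" for a i k
  proof (induction k)
    case 0
    then show ?case using pi_one[OF that(2)] by simp
  next
    case (Suc k)
    have "[\<pi> (a [^] Suc k) i = \<pi> (a [^] k) i + \<pi> a i] (mod r)"
      using hom[of "a [^] k" a i] that by simp
    also have "[\<pi> (a [^] k) i + \<pi> a i = int k * \<pi> a i + \<pi> a i] (mod r)"
      using Suc by (intro cong_add cong_refl)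
    finally show ?case by (simp add: algebra_simps)
  qed
  have pi_int_pow: "[\<pi> (a [^] k) i = k * \<pi> a i] (mod r)" if "a \<in> carrier G" "i < m" for a i and k :: int
  proof (cases "k < 0")
    case False
    then show ?thesis using pi_nat_pow[OF that, of "nat k"] by (subst int_pow_def2, simp)
  next
    case True
    have "[\<pi> (inv (a [^] nat (- k))) i = - \<pi> (a [^] nat (- k)) i] (mod r)"
      using that by (intro pi_inv) simp_all
    also have "[- \<pi> (a [^] nat (- k)) i = - (int (nat (- k)) * \<pi> a i)] (mod r)"
      using pi_nat_pow[OF that, of "nat (- k)"] by (simp only: cong_minus_minus_iff)
    finally show ?thesis using True by (subst int_pow_def2, simp)
  qed
  have coset: "finite {x \<in> carrier G. \<forall>i<m. [\<pi> x i = \<pi> a i] (mod r)}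
      \<and> card {x \<in> carrier G. \<forall>i<m. [\<pi> x i = \<pi> a i] (mod r)} \<le> card ?K" if a: "a \<in> carrier G" for a
  proof -
    have "{x \<in> carrier G. \<forall>i<m. [\<pi> x i = \<pi> a i] (mod r)} \<subseteq> (\<lambda>k. a \<otimes> k) ` ?K"
    proof
      fix x assume "x \<in> {x \<in> carrier G. \<forall>i<m. [\<pi> x i = \<pi> a i] (mod r)}"
      then have x: "x \<in> carrier G" "\<And>i. i < m \<Longrightarrow> [\<pi> x i = \<pi> a i] (mod r)" by auto
      have "[\<pi> (inv a \<otimes> x) i = 0] (mod r)" if i: "i < m" for i
      proof -
        have "[\<pi> (inv a \<otimes> x) i = \<pi> (inv a) i + \<pi> x i] (mod r)"
          using a x(1) i by (intro hom) simp_all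
        also have "[\<pi> (inv a) i + \<pi> x i = - \<pi> a i + \<pi> a i] (mod r)"
          using a x(2)[OF i] i by (intro cong_add pi_inv)
        finally show ?thesis by simp
      qed
      then have "inv a \<otimes> x \<in> ?K" using a x(1) by simp
      moreover have "x = a \<otimes> (inv a \<otimes> x)"
        using a x(1) by (simp add: m_assoc[symmetric])
      ultimately show "x \<in> (\<lambda>k. a \<otimes> k) ` ?K" by (rule rev_image_eqI)
    qed
    then show ?thesis
      using fin card_image_le[OF fin, of "\<lambda>k. a \<otimes> k"]
        card_mono[of "(\<lambda>k. a \<otimes> k) ` ?K"] by (meson finite_imageI finite_subset le_trans)
  qed
  have dvdN: "j - i dvd ?N" if "i < j" "j \<le> card ?K" for i j
    using that by (intro dvd_fact) simp_all
  \<comment> \<open>The conjugates of \<open>a\<close> by powers of \<open>b\<close> all lie in the finite coset of \<open>a\<close>, so two of them coincide.\<close>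
  have commute: "b [^] ?N \<otimes> a = a \<otimes> b [^] ?N" if a: "a \<in> carrier G" and b: "b \<in> carrier G" for a b
  proof -
    let ?S = "{x \<in> carrier G. \<forall>i<m. [\<pi> x i = \<pi> a i] (mod r)}"
    let ?w = "\<lambda>k::nat. b [^] k \<otimes> a \<otimes> inv (b [^] k)"
    have wS: "?w k \<in> ?S" for k
    proof -
      have "[\<pi> (?w k) i = \<pi> a i] (mod r)" if i: "i < m" for i
      proof -
        have "[\<pi> (?w k) i = \<pi> (b [^] k \<otimes> a) i + \<pi> (inv (b [^] k)) i] (mod r)"
          using a b i by (intro hom) simp_all
        also have "[\<pi> (b [^] k \<otimes> a) i + \<pi> (inv (b [^] k)) i =
            (\<pi> (b [^] k) i + \<pi> a i) + - \<pi> (b [^] k) i] (mod r)"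
          using a b i by (intro cong_add hom pi_inv) simp_all
        finally show ?thesis by simp
      qed
      then show ?thesis using a b by simp
    qed
    obtain i j where ij: "i < j" "j \<le> card ?S" "?w i = ?w j"
      by (rule pigeonhole_sequence[OF conjunct1[OF coset[OF a]], of ?w]) (rule wS, rule that)
    define d where "d = j - i"
    have j: "j = i + d" using ij(1) by (simp add: d_def)
    have c: "b [^] i \<in> carrier G" "b [^] d \<in> carrier G" using b by simp_all
    have bj: "b [^] j = b [^] i \<otimes> b [^] d"
      using b by (simp add: j nat_pow_mult)
    have "b [^] i \<otimes> (a \<otimes> inv (b [^] i)) = b [^] i \<otimes> (b [^] d \<otimes> a \<otimes> inv (b [^] d) \<otimes> inv (b [^] i))"
      using ij(3) a c unfolding bj by (simp add: m_assoc inv_mult_group)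
    then have "a \<otimes> inv (b [^] i) = b [^] d \<otimes> a \<otimes> inv (b [^] d) \<otimes> inv (b [^] i)"
      by (rule left_cancel_imp) (use a c in simp_all)
    then have "a = b [^] d \<otimes> a \<otimes> inv (b [^] d)"
      by (rule right_cancel_imp) (use a c in simp_all)
    then have "a \<otimes> b [^] d = b [^] d \<otimes> a \<otimes> inv (b [^] d) \<otimes> b [^] d"
      by simp
    also have "\<dots> = b [^] d \<otimes> a"
      using a c by (simp add: m_assoc)
    finally have bd: "b [^] d \<otimes> a = a \<otimes> b [^] d" by simp
    have "d dvd ?N"
      unfolding d_def using ij(1,2) conjunct2[OF coset[OF a]] by (intro dvdN) linarith+
    then obtain l where l: "?N = d * l" by (auto elim: dvdE)
    have "b [^] ?N = (b [^] d) [^] l"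
      unfolding l using b by (simp add: nat_pow_pow)
    then show ?thesis
      using commutes_nat_pow[OF c(2) a bd, of l] by simp
  qed
  have exponent: "x [^] ?N = \<one>" if x: "x \<in> ?K" for x
  proof -
    have xc: "x \<in> carrier G" using x by simp
    have "x [^] k \<in> ?K" for k :: nat
    proof -
      have "[\<pi> (x [^] k) i = 0] (mod r)" if i: "i < m" for i
      proof -
        have "[\<pi> (x [^] k) i = int k * \<pi> x i] (mod r)" using xc i by (rule pi_nat_pow)
        also have "[int k * \<pi> x i = int k * 0] (mod r)" using x i by (intro cong_mult cong_refl) simp
        finally show ?thesis by simp
      qed
      then show ?thesis using xc by simp
    qed
    then obtain i j where ij: "i < j" "j \<le> card ?K" "x [^] i = x [^] j"
      by (rule pigeonhole_sequence[OF fin, of "\<lambda>k. x [^] k"]) (rule that)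
    define d where "d = j - i"
    have "x [^] i \<otimes> x [^] d = x [^] j"
      using ij(1) xc by (simp add: d_def nat_pow_mult)
    then have "x [^] i \<otimes> x [^] d = x [^] i \<otimes> \<one>"
      using ij(3) xc by simp
    then have xd: "x [^] d = \<one>"
      by (rule left_cancel_imp) (use xc in simp_all)
    obtain l where "?N = d * l" using dvdN[OF ij(1,2)] by (auto simp: d_def elim: dvdE)
    then have "x [^] ?N = (x [^] d) [^] l"
      using xc by (simp add: nat_pow_pow)
    then show ?thesis using xd by simp
  qed
  have "\<forall>j\<in>{..<m}. \<exists>a. a \<in> carrier G \<and> (\<forall>i<m. [\<pi> a i = (if i = j then D else 0)] (mod r))"
    using lifts by blast
  from bchoice[OF this] obtain a where
    a: "\<And>j. j < m \<Longrightarrow> a j \<in> carrier G"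
       "\<And>j i. j < m \<Longrightarrow> i < m \<Longrightarrow> [\<pi> (a j) i = (if i = j then D else 0)] (mod r)"
    by auto
  define b where "b j = a j [^] ?N" for j
  define D' where "D' = D * int ?N"
  have D': "D' > 0" using D by (simp add: D'_def)
  have bG: "b j \<in> carrier G" if "j < m" for j
    using a(1)[OF that] by (simp add: b_def)
  have bcomm: "b i \<otimes> b j = b j \<otimes> b i" if "i < m" "j < m" for i j
    unfolding b_def[of i] by (rule commute) (use a(1) bG that in simp_all)
  have pib: "[\<pi> (b j) i = (if i = j then D' else 0)] (mod r)" if "j < m" "i < m" for i j
  proof -
    have "[\<pi> (b j) i = int ?N * \<pi> (a j) i] (mod r)"
      unfolding b_def using a(1)[OF that(1)] that(2) by (rule pi_nat_pow)
    also have "[int ?N * \<pi> (a j) i = int ?N * (if i = j then D else 0)] (mod r)"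
      using a(2)[OF that] by (intro cong_mult cong_refl)
    finally show ?thesis by (simp add: D'_def mult.commute split: if_splits)
  qed
  let ?W = "\<lambda>k. power_word G b k m"
  have WG: "?W k \<in> carrier G" for k
    using bG by (rule power_word_closed)
  have Wadd: "?W (\<lambda>i. k i + l i) = ?W k \<otimes> ?W l" for k l
    using bG bcomm by (rule power_word_add)
  have piW': "[\<pi> (power_word G b k n) i = (if i < n then D' * k i else 0)] (mod r)"
    if "n \<le> m" "i < m" for k n i
    using that
  proof (induction n)
    case 0
    then show ?case using pi_one by simp
  next
    case (Suc n)
    have pw: "power_word G b k n \<in> carrier G" and bn: "b n \<in> carrier G"
      using bG Suc.prems(1) by (simp_all add: power_word_closed)
    have "[\<pi> (power_word G b k (Suc n)) i = \<pi> (power_word G b k n) i + \<pi> (b n [^] k n) i] (mod r)"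
      using hom[OF pw int_pow_closed[OF bn, of "k n"] Suc.prems(2)] by simp
    also have "[\<pi> (power_word G b k n) i + \<pi> (b n [^] k n) i =
        (if i < n then D' * k i else 0) + k n * \<pi> (b n) i] (mod r)"
      using Suc bn by (intro cong_add pi_int_pow) simp_all
    also have "[(if i < n then D' * k i else 0) + k n * \<pi> (b n) i =
        (if i < n then D' * k i else 0) + k n * (if i = n then D' else 0)] (mod r)"
      using Suc.prems by (intro cong_add cong_mult cong_refl pib) simp_all
    also have "(if i < n then D' * k i else 0) + k n * (if i = n then D' else 0) =
        (if i < Suc n then D' * k i else 0)"
      by (auto simp: less_Suc_eq mult.commute)
    finally show ?case .
  qed
  have piW: "[\<pi> (?W k) i = D' * k i] (mod r)" if "i < m" for k i
    using piW'[OF order_refl that, of k] that by simp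
  have Wscale: "?W (\<lambda>i. int c * k i) = ?W k [^] c" for c k
  proof (induction c)
    case 0
    then show ?case by (simp add: power_word_zero)
  next
    case (Suc c)
    have "?W (\<lambda>i. int (Suc c) * k i) = ?W (\<lambda>i. int c * k i + k i)"
      by (simp add: algebra_simps)
    then show ?case using Suc by (simp add: Wadd)
  qed
  \<comment> \<open>The order of \<open>D'\<close> in \<open>\<int>/r\<close>: the word \<open>?W k\<close> lies in the kernel of \<open>\<pi>\<close> exactly when \<open>s\<close> divides all \<open>k i\<close>.\<close>
  define s where "s = r div gcd r D'"
  have rs: "r = s * gcd r D'" by (simp add: s_def)
  have gpos: "gcd r D' > 0" using r by (simp add: gcd_pos_int)
  have spos: "s > 0" using rs r gpos by (metis zero_less_mult_pos2)
  have "gcd r D' \<le> D'" using D' by (intro zdvd_imp_le) simp_all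
  then have rle: "r \<le> s * D'"
    using spos by (subst rs) (simp add: mult_left_mono)
  have dvd_iff: "r dvd D' * x \<longleftrightarrow> s dvd x" for x
  proof -
    have Dg: "D' = (D' div gcd r D') * gcd r D'" by simp
    have cop: "coprime s (D' div gcd r D')"
      unfolding s_def using r by (intro div_gcd_coprime) simp
    have "r dvd D' * x \<longleftrightarrow> s * gcd r D' dvd (D' div gcd r D') * x * gcd r D'"
      using rs Dg by (metis mult.assoc mult.commute)
    also have "\<dots> \<longleftrightarrow> s dvd (D' div gcd r D') * x"
      using gpos by (simp only: dvd_mult_cancel_right) auto
    also have "\<dots> \<longleftrightarrow> s dvd x"
      using cop by (rule coprime_dvd_mult_right_iff)
    finally show ?thesis .
  qed
  have kernel_dvd: "s dvd k i" if "?W k = \<one>" "i < m" for k i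
  proof -
    have "[D' * k i = \<pi> \<one> i] (mod r)" using piW[OF that(2), of k] that(1) by (simp add: cong_sym)
    then have "[D' * k i = 0] (mod r)" using pi_one[OF that(2)] by (rule cong_trans)
    then show ?thesis using dvd_iff by (simp add: cong_0_iff)
  qed
  \<comment> \<open>The relations among the \<open>b j\<close> are exactly the vectors \<open>s * v\<close> with \<open>v\<close> in \<open>L\<close>.\<close>
  define L where "L = {v. (\<forall>i\<ge>m. v i = 0) \<and> ?W (\<lambda>i. s * v i) = \<one>}"
  have L_add: "(\<lambda>i. u i + v i) \<in> L" if "u \<in> L" "v \<in> L" for u v
    using that Wadd[of "\<lambda>i. s * u i" "\<lambda>i. s * v i"] by (simp add: L_def distrib_left)
  have L_minus: "(\<lambda>i. - v i) \<in> L" if v: "v \<in> L" for v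
  proof -
    have "?W (\<lambda>i. s * v i + s * - v i) = \<one>"
      by (simp add: power_word_zero)
    moreover have "?W (\<lambda>i. s * v i) = \<one>" using v by (simp add: L_def)
    ultimately have "?W (\<lambda>i. s * - v i) = \<one>"
      using WG[of "\<lambda>i. s * - v i"] unfolding Wadd by simp
    then show ?thesis using v by (simp add: L_def)
  qed
  have L_diff: "(\<lambda>i. u i - v i) \<in> L" if "u \<in> L" "v \<in> L" for u v
    using L_add[OF that(1) L_minus[OF that(2)]] by simp
  have L_unit: "(\<lambda>i. if i = j then int ?N else 0) \<in> L" if j: "j < m" for j
  proof -
    let ?x = "?W (\<lambda>i. if i = j then s else 0)"
    have "[\<pi> ?x i = 0] (mod r)" if i: "i < m" for i
    proof -
      have "[\<pi> ?x i = D' * (if i = j then s else 0)] (mod r)" using i by (rule piW)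
      also have "[D' * (if i = j then s else 0) = 0] (mod r)"
        unfolding cong_0_iff dvd_iff by simp
      finally show ?thesis .
    qed
    then have "?x \<in> ?K" using WG by simp
    then have "?W (\<lambda>i. int ?N * (if i = j then s else 0)) = \<one>"
      unfolding Wscale by (rule exponent)
    moreover have "(\<lambda>i. int ?N * (if i = j then s else 0)) = (\<lambda>i. s * (if i = j then int ?N else 0))"
      by auto
    ultimately have "?W (\<lambda>i. s * (if i = j then int ?N else 0)) = \<one>"
      by simp
    then show ?thesis using j by (simp add: L_def)
  qed
  have L_supp: "u i = 0" if "u \<in> L" "i \<ge> m" for u i
    using that by (simp add: L_def)
  have Npos: "int ?N > 0" by simp
  have "\<exists>f. (\<forall>j<m. f j \<in> L) \<and> (\<forall>v\<in>L. \<exists>y. \<forall>i. v i = (\<Sum>j<m. y j * f j i)) \<and>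
      (\<forall>y. (\<forall>i. (\<Sum>j<m. y j * f j i) = 0) \<longrightarrow> (\<forall>j<m. y j = 0))"
    by (rule int_lattice_basis[of L m "int ?N"]) ((rule L_diff L_supp L_unit, assumption+) | rule Npos)+
  then obtain f where f: "\<And>j. j < m \<Longrightarrow> f j \<in> L"
    "\<And>v. v \<in> L \<Longrightarrow> \<exists>y. \<forall>i. v i = (\<Sum>j<m. y j * f j i)"
    "\<And>y j. (\<And>i. (\<Sum>j<m. y j * f j i) = 0) \<Longrightarrow> j < m \<Longrightarrow> y j = 0"
    by blast
  define F where "F y = (\<lambda>i. \<Sum>j<m. y j * f j i)" for y :: "nat \<Rightarrow> int"
  have F_add: "F (\<lambda>j. x j + y j) = (\<lambda>i. F x i + F y i)" for x y
    by (simp add: F_def fun_eq_iff sum.distrib algebra_simps)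
  have F_scale: "F (\<lambda>j. c * y j) = (\<lambda>i. c * F y i)" for c y
    by (simp add: F_def fun_eq_iff sum_distrib_left mult.assoc)
  have F_cong: "F x = F y" if "\<And>j. j < m \<Longrightarrow> x j = y j" for x y
    using that by (auto simp: F_def fun_eq_iff intro!: sum.cong)
  have F_supp: "F y i = 0" if "i \<ge> m" for y i
    unfolding F_def using L_supp[OF f(1) that] by (intro sum.neutral) simp
  have kernel: "?W (F y) = \<one> \<longleftrightarrow> (\<forall>j<m. s dvd y j)" for y
  proof
    assume *: "?W (F y) = \<one>"
    define v where "v i = F y i div s" for i
    have Fy: "F y i = s * v i" for i
      using kernel_dvd[OF *, of i] F_supp[of i y] by (cases "i < m") (simp_all add: v_def)
    then have "F y = (\<lambda>i. s * v i)" by (rule ext)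
    then have "v \<in> L"
      using * F_supp[of _ y] spos by (auto simp: L_def v_def)
    then obtain z where z: "\<And>i. v i = F z i" using f(2) unfolding F_def by blast
    have "F (\<lambda>j. y j + (- s) * z j) i = 0" for i
      unfolding F_add F_scale by (simp add: Fy z)
    then have "y j + (- s) * z j = 0" if "j < m" for j
      using f(3)[of "\<lambda>j. y j + (- s) * z j" j] that unfolding F_def by blast
    then show "\<forall>j<m. s dvd y j"
      by (metis add_eq_0_iff dvd_triv_left minus_mult_left minus_minus)
  next
    assume *: "\<forall>j<m. s dvd y j"
    have gen: "?W (\<lambda>i. s * (\<Sum>j<n. z j * f j i)) = \<one>" if "n \<le> m" for n and z :: "nat \<Rightarrow> int"
      using that
    proof (induction n)
      case 0
      then show ?case by (simp add: power_word_zero)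
    next
      case (Suc n)
      have fn: "f n \<in> L" using f(1) Suc.prems by simp
      have nat_case: "?W (\<lambda>i. int c * (s * f n i)) = \<one>" for c
        unfolding Wscale using fn by (simp add: L_def)
      have nat_case': "?W (\<lambda>i. int c * (s * - f n i)) = \<one>" for c
        unfolding Wscale using L_minus[OF fn] by (simp add: L_def)
      have int_case: "?W (\<lambda>i. s * (z n * f n i)) = \<one>"
      proof (cases "z n \<ge> 0")
        case True
        then show ?thesis using nat_case[of "nat (z n)"] by (simp add: mult.left_commute)
      next
        case False
        then show ?thesis using nat_case'[of "nat (- z n)"] by (simp add: mult.left_commute)
      qed
      have "?W (\<lambda>i. s * (\<Sum>j<Suc n. z j * f j i)) =
          ?W (\<lambda>i. s * (\<Sum>j<n. z j * f j i) + s * (z n * f n i))"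
        by (simp add: distrib_left)
      also have "\<dots> = \<one>"
        unfolding Wadd using Suc int_case by simp
      finally show ?case .
    qed
    have "F y = F (\<lambda>j. s * (y j div s))"
      using * by (intro F_cong) simp
    then show "?W (F y) = \<one>"
      using gen[OF order_refl, of "\<lambda>j. y j div s"] unfolding F_scale F_def by simp
  qed
  have carrier_Z: "carrier (Zmod_power s m) = (\<Pi>\<^sub>E i\<in>{..<m}. {0..<s})"
    using spos by (simp add: Zmod_power_def carrier_integer_mod_group)
  define \<psi> where "\<psi> y = ?W (F y)" for y
  have "\<psi> \<in> hom (Zmod_power s m) G"
  proof (rule homI)
    show "\<psi> x \<in> carrier G" for x unfolding \<psi>_def by (rule WG)
    fix x y
    let ?z = "x \<otimes>\<^bsub>Zmod_power s m\<^esub> y"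
    have z: "?z j = (x j + y j) mod s" if "j < m" for j
      using that spos by (simp add: Zmod_power_def)
    have "F (\<lambda>j. x j + y j) = F (\<lambda>j. ?z j + s * ((x j + y j) div s))"
      by (rule F_cong) (simp add: z)
    then have "?W (\<lambda>i. F x i + F y i) = ?W (\<lambda>i. F ?z i + F (\<lambda>j. s * ((x j + y j) div s)) i)"
      unfolding F_add by simp
    moreover have "?W (F (\<lambda>j. s * ((x j + y j) div s))) = \<one>"
      unfolding kernel by simp
    ultimately show "\<psi> ?z = \<psi> x \<otimes> \<psi> y"
      unfolding \<psi>_def Wadd using WG by simp
  qed
  moreover have "inj_on \<psi> (carrier (Zmod_power s m))"
  proof (rule inj_onI)
    fix x y assume xy: "x \<in> carrier (Zmod_power s m)" "y \<in> carrier (Zmod_power s m)" "\<psi> x = \<psi> y"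
    have "F x = F (\<lambda>j. y j + (x j - y j))" by simp
    then have "?W (F y) \<otimes> ?W (F (\<lambda>j. x j - y j)) = ?W (F y) \<otimes> \<one>"
      using xy(3) WG unfolding \<psi>_def F_add by (simp add: Wadd)
    then have "?W (F (\<lambda>j. x j - y j)) = \<one>"
      by (rule left_cancel_imp) (use WG in simp_all)
    then have dvd: "s dvd x j - y j" if "j < m" for j
      using that unfolding kernel by blast
    have "x j = y j" if j: "j < m" for j
    proof -
      have "x j \<in> {0..<s}" "y j \<in> {0..<s}" 
        using PiE_mem[OF xy(1)[unfolded carrier_Z], of j] PiE_mem[OF xy(2)[unfolded carrier_Z], of j] j
        by simp_all
      then have "\<bar>x j - y j\<bar> < s" by auto
      then have "x j - y j = 0"
        using dvd_imp_le_int[OF _ dvd[OF j]] spos by linarith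
      then show ?thesis by simp
    qed
    then show "x = y"
      using xy(1,2) unfolding carrier_Z by (intro PiE_ext[of x "{..<m}" "\<lambda>_. {0..<s}" y]) simp_all
  qed
  moreover have "r \<le> s * (D * fact (card K))" using rle by (simp add: D'_def K)
  ultimately show thesis using spos by (intro that[of s \<psi>])
qed

section \<open>Lifting the actions\<close>

lemma group_Zmod_power: "group (Zmod_power r m)"
  by (simp add: Zmod_power_def)

lemma carrier_Zmod_power: "r > 0 \<Longrightarrow> carrier (Zmod_power r m) = (\<Pi>\<^sub>E i\<in>{..<m}. {0..<r})"
  by (simp add: Zmod_power_def carrier_integer_mod_group)

lemma mult_Zmod_power:
  "r > 0 \<Longrightarrow> i < m \<Longrightarrow> (x \<otimes>\<^bsub>Zmod_power r m\<^esub> y) i = (x i + y i) mod r"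
  by (simp add: Zmod_power_def)

lemma one_Zmod_power: "\<one>\<^bsub>Zmod_power r m\<^esub> = (\<lambda>i\<in>{..<m}. 0)"
  by (simp add: Zmod_power_def)

lemma pow_Zmod_power:
  assumes "r > 0" "i < m"
  shows "(x [^]\<^bsub>Zmod_power r m\<^esub> (k::nat)) i = (int k * x i) mod r"
proof (induction k)
  case 0
  then show ?case using assms by (simp add: one_Zmod_power)
next
  case (Suc k)
  then show ?case
    using assms by (simp add: mult_Zmod_power algebra_simps mod_add_right_eq)
qed

lemma faithful_actionD:
  assumes "faithful_action G S \<phi>"
  shows "group_action G S \<phi>" "inj_on \<phi> (carrier G)"
  using assms by (simp_all add: faithful_action_def faithful_action_axioms_def)

lemma effective_continuous_action_homeomorphic:
  assumes act: "effective_continuous_action G X \<phi>" and g: "g \<in> carrier G"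
  shows "homeomorphic_map X X (\<phi> g)"
proof -
  have ga: "group_action G (topspace X) \<phi>"
    using act unfolding effective_continuous_action_def by (blast intro: faithful_actionD(1))
  then interpret group_action G "topspace X" \<phi> .
  interpret G: group G using group_hom by (simp add: group_hom_def)
  have c: "continuous_map X X (\<phi> h)" if "h \<in> carrier G" for h
    using act that by (simp add: effective_continuous_action_def)
  have inverse: "\<phi> h (\<phi> (inv\<^bsub>G\<^esub> h) x) = x" "\<phi> (inv\<^bsub>G\<^esub> h) (\<phi> h x) = x"
    if h: "h \<in> carrier G" and x: "x \<in> topspace X" for h x
  proof -
    have one: "\<phi> \<one>\<^bsub>G\<^esub> x = x"
      using x unfolding id_eq_one[symmetric] by simp
    show "\<phi> h (\<phi> (inv\<^bsub>G\<^esub> h) x) = x"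
      using composition_rule[OF x h G.inv_closed[OF h]] h one by simp
    show "\<phi> (inv\<^bsub>G\<^esub> h) (\<phi> h x) = x"
      using composition_rule[OF x G.inv_closed[OF h] h] h one by simp
  qed
  have "homeomorphic_maps X X (\<phi> g) (\<phi> (inv\<^bsub>G\<^esub> g))"
    unfolding homeomorphic_maps_def using c[OF g] c[OF G.inv_closed[OF g]] inverse[OF g] by simp
  then show ?thesis by (rule homeomorphic_maps_map[THEN iffD1, THEN conjunct1])
qed

lemma (in group_action) action_funpow:
  assumes "group G" "g \<in> carrier G" "x \<in> E"
  shows "(\<phi> g ^^ k) x = \<phi> (g [^]\<^bsub>G\<^esub> (k::nat)) x"
proof (induction k)
  case 0
  interpret G: group G by (rule assms(1))
  show ?case using assms(3) by (simp add: id_eq_one[symmetric])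
next
  case (Suc k)
  interpret G: group G by (rule assms(1))
  have "(\<phi> g ^^ Suc k) x = \<phi> g (\<phi> (g [^]\<^bsub>G\<^esub> k) x)"
    using Suc by simp
  also have "\<dots> = \<phi> (g \<otimes>\<^bsub>G\<^esub> g [^]\<^bsub>G\<^esub> k) x"
    using composition_rule[OF assms(3,2), of "g [^]\<^bsub>G\<^esub> k"] assms(2) by simp
  finally show ?case by (simp only: G.nat_pow_Suc2[OF assms(2)])
qed

lemma restrict_homeomorphic:
  assumes "homeomorphic_map E E f"
  shows "restrict f (topspace E) \<in> Bij (topspace E)" "homeomorphic_map E E (restrict f (topspace E))"
proof -
  show "homeomorphic_map E E (restrict f (topspace E))"
    using assms by (rule homeomorphic_map_eq) simp
  have "bij_betw f (topspace E) (topspace E)"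
    using homeomorphic_imp_injective_map[OF assms] homeomorphic_imp_surjective_map[OF assms]
    by (simp add: bij_betw_def)
  then show "restrict f (topspace E) \<in> Bij (topspace E)"
    unfolding Bij_def by simp
qed

definition lifted_group ::
    "('g, 'm) monoid_scheme \<Rightarrow> ('g \<Rightarrow> 'a \<Rightarrow> 'a) \<Rightarrow> 'b topology \<Rightarrow> ('b \<Rightarrow> 'a) \<Rightarrow> ('b \<Rightarrow> 'b) set" where
  "lifted_group G \<phi> E p = {f \<in> Bij (topspace E). homeomorphic_map E E f \<and>
     (\<exists>g\<in>carrier G. \<forall>e\<in>topspace E. p (f e) = \<phi> g (p e))}"

lemma subgroup_lifted_group:
  assumes act: "effective_continuous_action G X \<phi>" and G: "group G"
    and p: "p ` topspace E = topspace X"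
  shows "subgroup (lifted_group G \<phi> E p) (BijGroup (topspace E))"
proof -
  interpret group_action G "topspace X" \<phi>
    using act unfolding effective_continuous_action_def by (blast intro: faithful_actionD(1))
  interpret G: group G by (rule G)
  let ?B = "BijGroup (topspace E)"
  interpret B: group ?B by (rule group_BijGroup)
  have pE: "p e \<in> topspace X" if "e \<in> topspace E" for e using p that by blast
  have fE: "f e \<in> topspace E" if "f \<in> Bij (topspace E)" "e \<in> topspace E" for f e
    using Bij_imp_funcset[OF that(1)] that(2) by blast
  show ?thesis
  proof (rule B.subgroupI)
    show "lifted_group G \<phi> E p \<subseteq> carrier ?B"
      by (auto simp: lifted_group_def BijGroup_def)
    have "(\<lambda>e\<in>topspace E. e) \<in> lifted_group G \<phi> E p"
      unfolding lifted_group_def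
    proof (intro CollectI conjI bexI[of _ "\<one>\<^bsub>G\<^esub>"] ballI)
      show "(\<lambda>e\<in>topspace E. e) \<in> Bij (topspace E)" by (rule id_Bij)
      have "homeomorphic_map E E (\<lambda>e. e)" by (simp add: homeomorphic_map_id[unfolded id_def])
      then show "homeomorphic_map E E (\<lambda>e\<in>topspace E. e)"
        by (rule restrict_homeomorphic)
      fix e assume e: "e \<in> topspace E"
      show "p ((\<lambda>e\<in>topspace E. e) e) = \<phi> \<one>\<^bsub>G\<^esub> (p e)"
        using pE[OF e] e by (simp add: id_eq_one[symmetric])
    qed simp
    then show "lifted_group G \<phi> E p \<noteq> {}" by blast
  next
    fix f assume f: "f \<in> lifted_group G \<phi> E p"
    then obtain g where fB: "f \<in> Bij (topspace E)" and fh: "homeomorphic_map E E f"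
      and g: "g \<in> carrier G" "\<And>e. e \<in> topspace E \<Longrightarrow> p (f e) = \<phi> g (p e)"
      unfolding lifted_group_def by blast
    obtain h where h: "homeomorphic_maps E E f h" using fh by (auto simp: homeomorphic_map_maps)
    then have hh: "homeomorphic_map E E h" and fh: "\<And>e. e \<in> topspace E \<Longrightarrow> f (h e) = e"
      and hf: "\<And>e. e \<in> topspace E \<Longrightarrow> h (f e) = e"
      by (auto simp: homeomorphic_map_maps homeomorphic_maps_def)
    have hE: "h e \<in> topspace E" if "e \<in> topspace E" for e
      using homeomorphic_imp_surjective_map[OF hh] that by blast
    let ?h = "restrict h (topspace E)"
    have hB: "?h \<in> Bij (topspace E)" "homeomorphic_map E E ?h"
      using restrict_homeomorphic[OF hh] by simp_all
    have "inv\<^bsub>?B\<^esub> f = ?h"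
    proof (rule B.inv_equality)
      show "?h \<otimes>\<^bsub>?B\<^esub> f = \<one>\<^bsub>?B\<^esub>"
        using fB hB(1) fE[OF fB] hf by (simp add: BijGroup_def compose_def fun_eq_iff)
    qed (use fB hB(1) in \<open>simp_all add: BijGroup_def\<close>)
    moreover have "?h \<in> lifted_group G \<phi> E p"
      unfolding lifted_group_def
    proof (intro CollectI conjI bexI[of _ "inv\<^bsub>G\<^esub> g"] ballI hB)
      fix e assume e: "e \<in> topspace E"
      have "p e = \<phi> g (p (h e))"
        using g(2)[OF hE[OF e]] fh[OF e] by simp
      then have "\<phi> (inv\<^bsub>G\<^esub> g) (p e) = \<phi> (inv\<^bsub>G\<^esub> g \<otimes>\<^bsub>G\<^esub> g) (p (h e))"
        using composition_rule[OF pE[OF hE[OF e]] G.inv_closed[OF g(1)] g(1)] by simp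
      also have "\<dots> = p (h e)"
        using g(1) pE[OF hE[OF e]] by (simp add: id_eq_one[symmetric])
      finally show "p (?h e) = \<phi> (inv\<^bsub>G\<^esub> g) (p e)" using e by simp
    qed (use g(1) in simp)
    ultimately show "inv\<^bsub>?B\<^esub> f \<in> lifted_group G \<phi> E p" by simp
  next
    fix f f' assume "f \<in> lifted_group G \<phi> E p" "f' \<in> lifted_group G \<phi> E p"
    then obtain g g' where f: "f \<in> Bij (topspace E)" "homeomorphic_map E E f"
      and f': "f' \<in> Bij (topspace E)" "homeomorphic_map E E f'"
      and g: "g \<in> carrier G" "\<And>e. e \<in> topspace E \<Longrightarrow> p (f e) = \<phi> g (p e)"
      and g': "g' \<in> carrier G" "\<And>e. e \<in> topspace E \<Longrightarrow> p (f' e) = \<phi> g' (p e)"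
      unfolding lifted_group_def by blast
    have eq: "f \<otimes>\<^bsub>?B\<^esub> f' = compose (topspace E) f f'"
      using f(1) f'(1) by (simp add: BijGroup_def)
    show "f \<otimes>\<^bsub>?B\<^esub> f' \<in> lifted_group G \<phi> E p"
      unfolding eq lifted_group_def
    proof (intro CollectI conjI bexI[of _ "g \<otimes>\<^bsub>G\<^esub> g'"] ballI)
      show "compose (topspace E) f f' \<in> Bij (topspace E)"
        using f(1) f'(1) by (rule compose_Bij)
      have "homeomorphic_map E E (f \<circ> f')"
        using f'(2) f(2) by (rule homeomorphic_map_compose)
      then show "homeomorphic_map E E (compose (topspace E) f f')"
        by (rule homeomorphic_map_eq) (simp add: compose_def)
      fix e assume e: "e \<in> topspace E"
      show "p (compose (topspace E) f f' e) = \<phi> (g \<otimes>\<^bsub>G\<^esub> g') (p e)"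
        using e g(2)[OF fE[OF f'(1) e]] g'(2)[OF e] composition_rule[OF pE[OF e] g(1) g'(1)]
        by (simp add: compose_def)
    qed (use g(1) g'(1) in simp)
  qed
qed

text \<open>The group of lifts is an extension of a large subgroup of \<open>(\<int>/r)\<^sup>m\<close> by deck transformations. The element of
\<open>(\<int>/r)\<^sup>m\<close> covered by a lift is unique, since the action on \<open>X\<close> is effective and \<open>p\<close> is onto.\<close>

lemma lifted_action:
  fixes E :: "'b topology" and X :: "'a topology"
  assumes p: "p ` topspace E = topspace X"
    and N: "N > 0" "\<And>g. homeomorphic_map X X g \<Longrightarrow>
        \<exists>f. homeomorphic_map E E f \<and> (\<forall>e\<in>topspace E. p (f e) = (g ^^ N) (p e))"
    and D: "D = {f \<in> Bij (topspace E). continuous_map E E f \<and> (\<forall>e\<in>topspace E. p (f e) = p e)}"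
    and fin: "finite D"
    and r: "r > 0" and act: "effective_continuous_action (Zmod_power r m) X \<phi>"
  obtains s \<psi> where "s > 0" "r \<le> s * (int N * fact (card D))"
    "effective_continuous_action (Zmod_power s m) E \<psi>"
proof -
  let ?Z = "Zmod_power r m" and ?B = "BijGroup (topspace E)"
  let ?C = "lifted_group ?Z \<phi> E p"
  let ?\<Gamma> = "?B\<lparr>carrier := ?C\<rparr>"
  have fa: "faithful_action ?Z (topspace X) \<phi>"
    using act by (simp add: effective_continuous_action_def)
  interpret group_action ?Z "topspace X" \<phi> using fa by (rule faithful_actionD(1))
  interpret Z: group ?Z by (rule group_Zmod_power)
  have sub: "subgroup ?C ?B"
    using act group_Zmod_power p by (rule subgroup_lifted_group)
  have grp: "group ?\<Gamma>"
    using group.subgroup_imp_group[OF group_BijGroup sub] .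
  interpret \<Gamma>: group ?\<Gamma> by (rule grp)
  have pE: "p e \<in> topspace X" if "e \<in> topspace E" for e using p that by blast
  have covers_unique: "g = g'" if g: "g \<in> carrier ?Z" "g' \<in> carrier ?Z"
    and eq: "\<And>e. e \<in> topspace E \<Longrightarrow> \<phi> g (p e) = \<phi> g' (p e)" for g g'
  proof -
    have ext: "\<phi> g \<in> extensional (topspace X)" "\<phi> g' \<in> extensional (topspace X)"
      using bij_prop0[OF g(1)] bij_prop0[OF g(2)] by (simp_all add: Bij_def)
    have "\<phi> g x = \<phi> g' x" if "x \<in> topspace X" for x
      using eq that unfolding p[symmetric] by blast
    then have "\<phi> g = \<phi> g'"
      using ext by (intro extensionalityI[of "\<phi> g" "topspace X" "\<phi> g'"])
    then show ?thesis
      using faithful_actionD(2)[OF fa] g by (simp add: inj_on_def)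
  qed
  define \<pi> where "\<pi> f = (SOME g. g \<in> carrier ?Z \<and> (\<forall>e\<in>topspace E. p (f e) = \<phi> g (p e)))" for f
  have \<pi>: "\<pi> f \<in> carrier ?Z" "\<And>e. e \<in> topspace E \<Longrightarrow> p (f e) = \<phi> (\<pi> f) (p e)" if f: "f \<in> ?C" for f
  proof -
    have "\<exists>g. g \<in> carrier ?Z \<and> (\<forall>e\<in>topspace E. p (f e) = \<phi> g (p e))"
      using f unfolding lifted_group_def by blast
    from someI_ex[OF this] show "\<pi> f \<in> carrier ?Z"
      "\<And>e. e \<in> topspace E \<Longrightarrow> p (f e) = \<phi> (\<pi> f) (p e)"
      unfolding \<pi>_def by blast+
  qed
  have \<pi>_eq: "\<pi> f = g" if "f \<in> ?C" "g \<in> carrier ?Z" "\<And>e. e \<in> topspace E \<Longrightarrow> p (f e) = \<phi> g (p e)" for f g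
    using \<pi>[OF that(1)] that(2,3) by (intro covers_unique) simp_all
  have CB: "f \<in> Bij (topspace E)" "homeomorphic_map E E f" if "f \<in> ?C" for f
    using that by (simp_all add: lifted_group_def)
  have \<pi>_mult: "\<pi> (f \<otimes>\<^bsub>?\<Gamma>\<^esub> f') = \<pi> f \<otimes>\<^bsub>?Z\<^esub> \<pi> f'" if f: "f \<in> ?C" "f' \<in> ?C" for f f'
  proof (rule \<pi>_eq)
    show "f \<otimes>\<^bsub>?\<Gamma>\<^esub> f' \<in> ?C" using \<Gamma>.m_closed[of f f'] f by simp
    show "\<pi> f \<otimes>\<^bsub>?Z\<^esub> \<pi> f' \<in> carrier ?Z" using \<pi>(1)[OF f(1)] \<pi>(1)[OF f(2)] by (rule Z.m_closed)
    fix e assume e: "e \<in> topspace E"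
    have "f' e \<in> topspace E" using Bij_imp_funcset[OF CB(1)[OF f(2)]] e by blast
    then show "p ((f \<otimes>\<^bsub>?\<Gamma>\<^esub> f') e) = \<phi> (\<pi> f \<otimes>\<^bsub>?Z\<^esub> \<pi> f') (p e)"
      using CB(1)[OF f(1)] CB(1)[OF f(2)] e \<pi>(2)[OF f(1), of "f' e"] \<pi>(2)[OF f(2) e]
        composition_rule[OF pE[OF e] \<pi>(1)[OF f(1)] \<pi>(1)[OF f(2)]]
      by (simp add: BijGroup_def compose_def)
  qed
  have hom: "[\<pi> (f \<otimes>\<^bsub>?\<Gamma>\<^esub> f') i = \<pi> f i + \<pi> f' i] (mod r)"
    if "f \<in> carrier ?\<Gamma>" "f' \<in> carrier ?\<Gamma>" "i < m" for f f' i
    using \<pi>_mult[of f f'] that r by (simp add: mult_Zmod_power cong_def)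
  let ?K = "{f \<in> carrier ?\<Gamma>. \<forall>i<m. [\<pi> f i = 0] (mod r)}"
  have KD: "?K \<subseteq> D"
  proof
    fix f assume "f \<in> ?K"
    then have f: "f \<in> ?C" "\<And>i. i < m \<Longrightarrow> [\<pi> f i = 0] (mod r)" by simp_all
    have "\<pi> f = \<one>\<^bsub>?Z\<^esub>"
    proof -
      have "\<pi> f i = 0" if i: "i < m" for i
      proof -
        have "\<pi> f i \<in> {0..<r}"
          using PiE_mem[OF \<pi>(1)[OF f(1), unfolded carrier_Zmod_power[OF r]]] i by simp
        then show ?thesis using f(2)[OF i] by (simp add: cong_def)
      qed
      then show ?thesis
        using \<pi>(1)[OF f(1)] unfolding carrier_Zmod_power[OF r] one_Zmod_power
        by (intro PiE_ext[of "\<pi> f" "{..<m}" "\<lambda>_. {0..<r}"]) (use r in auto)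
    qed
    then have "p (f e) = p e" if "e \<in> topspace E" for e
      using \<pi>(2)[OF f(1) that] pE[OF that] by (simp add: id_eq_one[symmetric])
    then show "f \<in> D"
      using CB[OF f(1)] homeomorphic_imp_continuous_map by (simp add: D)
  qed
  then have finK: "finite ?K" using fin by (rule finite_subset)
  have lifts: "\<exists>f\<in>carrier ?\<Gamma>. \<forall>i<m. [\<pi> f i = (if i = j then int N else 0)] (mod r)" if j: "j < m" for j
  proof -
    \<comment> \<open>The unit vector; the remainder matters only for \<open>r = 1\<close>.\<close>
    define g where "g = (\<lambda>i\<in>{..<m}. if i = j then 1 mod r else 0)"
    have g: "g \<in> carrier ?Z" using r by (simp add: g_def carrier_Zmod_power)
    obtain f where f: "homeomorphic_map E E f" "\<And>e. e \<in> topspace E \<Longrightarrow> p (f e) = (\<phi> g ^^ N) (p e)"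
      using N(2)[OF effective_continuous_action_homeomorphic[OF act g]] by blast
    let ?f = "restrict f (topspace E)"
    have gN: "g [^]\<^bsub>?Z\<^esub> N \<in> carrier ?Z" using g by simp
    have pf: "p (?f e) = \<phi> (g [^]\<^bsub>?Z\<^esub> N) (p e)" if e: "e \<in> topspace E" for e
      using f(2)[OF e] e action_funpow[OF Z.is_group g pE[OF e]] by simp
    have fC: "?f \<in> ?C"
      unfolding lifted_group_def using restrict_homeomorphic[OF f(1)] gN pf by blast
    have "\<pi> ?f = g [^]\<^bsub>?Z\<^esub> N"
      using fC gN pf by (rule \<pi>_eq)
    then have "[\<pi> ?f i = (if i = j then int N else 0)] (mod r)" if "i < m" for i
      using that r by (simp add: pow_Zmod_power g_def cong_def mod_mult_right_eq)
    then show ?thesis using fC by (intro bexI[of _ ?f]) simp_all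
  qed
  have Npos: "int N > 0" using N(1) by simp
  obtain s \<psi> where s: "s > 0" "r \<le> s * (int N * fact (card ?K))"
    and \<psi>: "\<psi> \<in> hom (Zmod_power s m) ?\<Gamma>" "inj_on \<psi> (carrier (Zmod_power s m))"
    by (rule \<Gamma>.Zmod_power_in_finite_extension[OF r Npos hom refl finK lifts])
  have "(fact (card ?K) :: int) \<le> fact (card D)"
    using card_mono[OF fin KD] by (rule fact_mono)
  then have "r \<le> s * (int N * fact (card D))"
    using s by (meson mult_left_mono order_trans of_nat_0_le_iff less_imp_le)
  moreover have "effective_continuous_action (Zmod_power s m) E \<psi>"
  proof -
    have \<psi>C: "\<psi> x \<in> ?C" if "x \<in> carrier (Zmod_power s m)" for x
      using hom_in_carrier[OF \<psi>(1) that] by simp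
    have "\<psi> \<in> hom (Zmod_power s m) ?B"
    proof (rule homI)
      show "\<psi> x \<in> carrier ?B" if "x \<in> carrier (Zmod_power s m)" for x
        using CB(1)[OF \<psi>C[OF that]] by (simp add: BijGroup_def)
      show "\<psi> (x \<otimes>\<^bsub>Zmod_power s m\<^esub> y) = \<psi> x \<otimes>\<^bsub>?B\<^esub> \<psi> y"
        if "x \<in> carrier (Zmod_power s m)" "y \<in> carrier (Zmod_power s m)" for x y
        using hom_mult[OF \<psi>(1) that] by simp
    qed
    then have "group_hom (Zmod_power s m) ?B \<psi>"
      by (intro group_hom.intro group_hom_axioms.intro group_Zmod_power group_BijGroup)
    then have "faithful_action (Zmod_power s m) (topspace E) \<psi>"
      using \<psi>(2) by (intro faithful_action.intro group_action.intro faithful_action_axioms.intro)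
    then show ?thesis
      unfolding effective_continuous_action_def
      using CB(2)[OF \<psi>C] homeomorphic_imp_continuous_map by blast
  qed
  ultimately show thesis using s(1) by (intro that)
qed

text \<open>The factor between \<open>r\<close> and \<open>s\<close> in the preceding lemma is the same for all actions, so \<open>s\<close> tends to infinity
with \<open>r\<close>.\<close>

lemma mu_subset_of_finite_covering:
  assumes X: "closed_manifold X" "connected_space X" and p: "finite_covering_map X' X p"
  shows "mu X \<subseteq> mu X'"
proof
  fix m assume "m \<in> mu X"
  then obtain r where r: "filterlim r at_top sequentially"
    "\<And>i. \<exists>\<phi>. effective_continuous_action (Zmod_power (r i) m) X \<phi>"
    unfolding mu_def by blast
  obtain N where N: "N > 0" "\<And>g. homeomorphic_map X X g \<Longrightarrow>
      \<exists>f. homeomorphic_map X' X' f \<and> (\<forall>e\<in>topspace X'. p (f e) = (g ^^ N) (p e))"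
    by (rule power_of_homeomorphism_lifts[OF X p]) (rule that)
  let ?D = "{f \<in> Bij (topspace X'). continuous_map X' X' f \<and> (\<forall>e\<in>topspace X'. p (f e) = p e)}"
  have finD: "finite ?D" using X p by (rule deck_transformations_finite)
  define B where "B = int N * fact (card ?D)"
  have B: "B > 0" using N(1) by (simp add: B_def)
  have im: "p ` topspace X' = topspace X"
    using p by (simp add: finite_covering_map_def covering_map_image)
  have "eventually (\<lambda>i. 1 \<le> r i) sequentially"
    using r(1) unfolding filterlim_at_top by blast
  \<comment> \<open>Finitely many terms of the sequence may fail to be positive; they are skipped.\<close>
  then obtain i0 where i0: "\<And>i. i \<ge> i0 \<Longrightarrow> r i > 0"
    unfolding eventually_sequentially by force
  have "\<forall>i. \<exists>s. s > 0 \<and> r (i + i0) \<le> s * B \<and> (\<exists>\<psi>. effective_continuous_action (Zmod_power s m) X' \<psi>)"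
  proof
    fix i
    have pos: "r (i + i0) > 0" by (rule i0) simp
    obtain \<phi> where act: "effective_continuous_action (Zmod_power (r (i + i0)) m) X \<phi>"
      using r(2) by blast
    obtain s \<psi> where "s > 0" "r (i + i0) \<le> s * (int N * fact (card ?D))"
      "effective_continuous_action (Zmod_power s m) X' \<psi>"
      by (rule lifted_action[OF im N refl finD pos act])
    then show "\<exists>s. s > 0 \<and> r (i + i0) \<le> s * B \<and> (\<exists>\<psi>. effective_continuous_action (Zmod_power s m) X' \<psi>)"
      unfolding B_def by blast
  qed
  from choice[OF this] obtain s where s: "\<And>i. r (i + i0) \<le> s i * B"
    "\<And>i. \<exists>\<psi>. effective_continuous_action (Zmod_power (s i) m) X' \<psi>"
    by blast
  have "filterlim s at_top sequentially"
    unfolding filterlim_at_top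
  proof
    fix c :: int
    have "eventually (\<lambda>i. c * B \<le> r i) sequentially"
      using r(1) unfolding filterlim_at_top by blast
    then have "eventually (\<lambda>i. c * B \<le> r (i + i0)) sequentially"
      by (rule eventually_sequentially_seg[THEN iffD2])
    then show "eventually (\<lambda>i. c \<le> s i) sequentially"
    proof eventually_elim
      case (elim i)
      then have "c * B \<le> s i * B" using s(1)[of i] by simp
      then show ?case using B by simp
    qed
  qed
  then show "m \<in> mu X'"
    unfolding mu_def using s(2) by blast
qed

theorem theorem1p12:
  fixes X :: "'a topology" and X' :: "'b topology" and p :: "'b \<Rightarrow> 'a"
  assumes "closed_manifold X" and "connected_space X"
    and "finite_covering_map X' X p"
  shows "disc_sym X' \<ge> disc_sym X"
proof -
  have sub: "mu X \<subseteq> mu X'"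
    using assms by (rule mu_subset_of_finite_covering)
  show ?thesis
  proof (cases "finite (mu X')")
    case True
    have fin: "finite (mu X)"
      using sub True by (rule finite_subset)
    have "Max ({0} \<union> mu X) \<le> Max ({0} \<union> mu X')"
      using sub True by (intro Max_mono) auto
    then show ?thesis
      using True fin by (simp add: disc_sym_def)
  next
    case False
    then show ?thesis by (simp add: disc_sym_def)
  qed
qed

end
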